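(* Let $Y$ be a MUCOGARCH$(1,1)$ volatility process with parameters $A,B\in M_d(\mathbb{R})$, $C\in\mathbb{S}_d^{++}$, driven by a Lévy process $L$ in $\mathbb{R}^d$. Let $k\in\mathbb{N}$, let $Y_0\in\mathbb{S}_d^+$ be such that $E(\|Y_0\|^k)<\infty$ and let $B$ be diagonalizable. Assume further that $E(\|L_1\|^{2k})<\infty$. Then $E(\|Y_t\|^k)<\infty$ for all $t\in\mathbb{R}^+$ and $t\mapsto E(\|Y_t\|^k)$ is locally bounded.
   Context: $M_d(\mathbb{R})$: real $d\times d$ matrices; $\mathbb{S}_d^+$ (resp. $\mathbb{S}_d^{++}$): positive semidefinite (resp. positive definite) symmetric $d\times d$ matrices; $X^*$ is the transpose; $X^{1/2}$ the positive semidefinite square root; $\mathbb{R}^+=[0,\infty)$; $\mathbb{N}=\{1,2,\dots\}$; $\|\cdot\|$ is any norm; diagonalizable means diagonalizable over $\mathbb{C}$. All processes live on a filtered probability space satisfying the usual conditions; $L$ is a càdlàg $\mathbb{R}^d$-valued Lévy process with respect to this filtration, $L_0=0$; $Y_0$ is $\mathcal{F}_0$-measurable. $[L,L]^{\mathfrak{d}}_t=\sum_{0\le s\le t}(\Delta L_s)(\Delta L_s)^*$. The MUCOGARCH$(1,1)$ volatility process with parameters $A,B,C$ driven by $L$ is the (unique) $\mathbb{S}_d^+$-valued càdlàg adapted solution of $$dY_t=(BY_{t-}+Y_{t-}B^* )\,dt+A(C+Y_{t-})^{1/2}\,d[L,L]_t^{\mathfrak{d}}\,(C+Y_{t-})^{1/2}A^*$$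 with initial value $Y_0$. *)

theory Defs
  imports "HOL-Probability.Probability"
begin

section \<open>Matrices\<close>

definition symmetric_matrix :: "real ^ 'n ^ 'n \<Rightarrow> bool" where
  "symmetric_matrix X \<longleftrightarrow> transpose X = X"

definition pos_semidef :: "real ^ 'n ^ 'n \<Rightarrow> bool" where
  "pos_semidef X \<longleftrightarrow> symmetric_matrix X \<and> (\<forall>v. 0 \<le> v \<bullet> (X *v v))"

definition pos_def :: "real ^ 'n ^ 'n \<Rightarrow> bool" where
  "pos_def X \<longleftrightarrow> symmetric_matrix X \<and> (\<forall>v. v \<noteq> 0 \<longrightarrow> 0 < v \<bullet> (X *v v))"

text \<open>The positive semidefinite square root; only meaningful if \<open>pos_semidef X\<close>.\<close>

definition mat_sqrt :: "real ^ 'n ^ 'n \<Rightarrow> real ^ 'n ^ 'n" where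
  "mat_sqrt X = (THE R. pos_semidef R \<and> R ** R = X)"

definition diagonalizable_over_complex :: "real ^ 'n ^ 'n \<Rightarrow> bool" where
  "diagonalizable_over_complex B \<longleftrightarrow>
     (\<exists>P D :: complex ^ 'n ^ 'n. invertible P \<and> (\<forall>i j. i \<noteq> j \<longrightarrow> D $ i $ j = 0) \<and>
        map_matrix complex_of_real B = P ** D ** matrix_inv P)"

definition is_norm :: "('v :: real_vector \<Rightarrow> real) \<Rightarrow> bool" where
  "is_norm N \<longleftrightarrow> (\<forall>x. N x = 0 \<longleftrightarrow> x = 0) \<and> (\<forall>c x. N (c *\<^sub>R x) = \<bar>c\<bar> * N x) \<and>
     (\<forall>x y. N (x + y) \<le> N x + N y)"


section \<open>Paths\<close>

text \<open>Paths have type \<open>real \<Rightarrow> _\<close>, but only their values on the time axis \<open>{0..}\<close> are used.\<close>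

definition cadlag :: "(real \<Rightarrow> 'b :: topological_space) \<Rightarrow> bool" where
  "cadlag f \<longleftrightarrow> (\<forall>t\<ge>0. (f \<longlongrightarrow> f t) (at_right t)) \<and> (\<forall>t>0. \<exists>l. (f \<longlongrightarrow> l) (at_left t))"

text \<open>At time \<open>0\<close> the left limit is the initial value, so there is no jump at \<open>0\<close>.\<close>

definition left_limit :: "(real \<Rightarrow> 'b :: t2_space) \<Rightarrow> real \<Rightarrow> 'b" where
  "left_limit f t = (if t \<le> 0 then f t else Lim (at_left t) f)"

definition jump :: "(real \<Rightarrow> 'b :: real_normed_vector) \<Rightarrow> real \<Rightarrow> 'b" where
  "jump f t = f t - left_limit f t"

text \<open>The discontinuous part of the quadratic variation, i.e. the sum of
  \<open>(\<Delta>L\<^sub>s)(\<Delta>L\<^sub>s)\<^sup>*\<close> over \<open>s\<close> in \<open>{0..t}\<close>.\<close>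

definition jump_quad_var :: "(real \<Rightarrow> real ^ 'n) \<Rightarrow> real \<Rightarrow> real ^ 'n ^ 'n" where
  "jump_quad_var l t = (\<Sum>\<^sub>\<infinity>s\<in>{0..t}. \<chi> i j. jump l s $ i * jump l s $ j)"

definition locally_bounded_on :: "real set \<Rightarrow> (real \<Rightarrow> real) \<Rightarrow> bool" where
  "locally_bounded_on S f \<longleftrightarrow> (\<forall>t\<in>S. \<exists>U. open U \<and> t \<in> U \<and> bounded (f ` (U \<inter> S)))"


section \<open>Lebesgue-Stieltjes integrals\<close>

text \<open>\<open>I\<close> is the integral of \<open>f\<close> over \<open>(a, b]\<close> with respect to a right-continuous \<open>g\<close> of
  finite variation, written on \<open>[a, b]\<close> as a difference of nondecreasing right-continuous functions.
  The value does not depend on the decomposition.\<close>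

definition has_stieltjes_integral ::
  "(real \<Rightarrow> real) \<Rightarrow> (real \<Rightarrow> real) \<Rightarrow> real \<Rightarrow> real \<Rightarrow> real \<Rightarrow> bool" where
  "has_stieltjes_integral f g a b I \<longleftrightarrow>
     (\<exists>g\<^sub>1 g\<^sub>2. mono g\<^sub>1 \<and> mono g\<^sub>2 \<and>
        (\<forall>x. continuous (at_right x) g\<^sub>1) \<and> (\<forall>x. continuous (at_right x) g\<^sub>2) \<and>
        (\<forall>x\<in>{a..b}. g x = g\<^sub>1 x - g\<^sub>2 x) \<and>
        set_integrable (interval_measure g\<^sub>1) {a<..b} f \<and>
        set_integrable (interval_measure g\<^sub>2) {a<..b} f \<and>
        I = (LINT x:{a<..b}|interval_measure g\<^sub>1. f x) - (LINT x:{a<..b}|interval_measure g\<^sub>2. f x))"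

text \<open>\<open>J\<close> is the integral of \<open>H\<^sub>s dX\<^sub>s K\<^sub>s\<close> over \<open>(a, b]\<close>: entry \<open>(i, j)\<close> is the sum over \<open>k\<close>, \<open>l\<close> of
  the integrals of \<open>H\<^sub>i\<^sub>k K\<^sub>l\<^sub>j\<close> with respect to \<open>X\<^sub>k\<^sub>l\<close>.\<close>

definition has_matrix_stieltjes_integral ::
  "(real \<Rightarrow> real ^ 'n ^ 'n) \<Rightarrow> (real \<Rightarrow> real ^ 'n ^ 'n) \<Rightarrow> (real \<Rightarrow> real ^ 'n ^ 'n) \<Rightarrow>
     real \<Rightarrow> real \<Rightarrow> real ^ 'n ^ 'n \<Rightarrow> bool" where
  "has_matrix_stieltjes_integral H X K a b J \<longleftrightarrow>
     (\<exists>I. (\<forall>i j k l. has_stieltjes_integral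
                       (\<lambda>s. H s $ i $ k * K s $ l $ j) (\<lambda>s. X s $ k $ l) a b (I i j k l)) \<and>
          J = (\<chi> i j. \<Sum>k\<in>UNIV. \<Sum>l\<in>UNIV. I i j k l))"


section \<open>Processes on a filtered probability space\<close>

text \<open>A filtered probability space satisfying the usual conditions. Only the sigma-algebras
  \<open>F t\<close> with \<open>0 \<le> t\<close> matter. The last assumption also makes \<open>M\<close> complete.\<close>

locale usual_filtered_prob_space = prob_space M for M :: "'a measure" +
  fixes F :: "real \<Rightarrow> 'a measure"
  assumes subalgebra_F: "\<And>t. 0 \<le> t \<Longrightarrow> subalgebra M (F t)"
    and F_mono: "\<And>s t. 0 \<le> s \<Longrightarrow> s \<le> t \<Longrightarrow> sets (F s) \<subseteq> sets (F t)"
    and F_right_continuous: "\<And>t. 0 \<le> t \<Longrightarrow> (\<Inter>s\<in>{t<..}. sets (F s)) = sets (F t)"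
    and F_complete: "\<And>Z S. Z \<in> null_sets M \<Longrightarrow> S \<subseteq> Z \<Longrightarrow> S \<in> sets (F 0)"
begin

definition adapted :: "(real \<Rightarrow> 'a \<Rightarrow> 'b :: topological_space) \<Rightarrow> bool" where
  "adapted X \<longleftrightarrow> (\<forall>t\<ge>0. X t \<in> borel_measurable (F t))"

text \<open>Levy process with respect to the filtration. Stochastic continuity is not listed since it
  follows from the stationarity of the increments and the cadlag paths.\<close>

definition levy_process :: "(real \<Rightarrow> 'a \<Rightarrow> real ^ 'n) \<Rightarrow> bool" where
  "levy_process L \<longleftrightarrow>
     adapted L \<and>
     (AE \<omega> in M. L 0 \<omega> = 0) \<and>
     (AE \<omega> in M. cadlag (\<lambda>t. L t \<omega>)) \<and>
     (\<forall>s t. 0 \<le> s \<and> s \<le> t \<longrightarrow>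
        indep_set (sets (F s)) (sets (vimage_algebra (space M) (\<lambda>\<omega>. L t \<omega> - L s \<omega>) borel)) \<and>
        distr M borel (\<lambda>\<omega>. L t \<omega> - L s \<omega>) = distr M borel (L (t - s)))"

text \<open>\<open>Y\<close> is an adapted cadlag solution, with values in the positive semidefinite matrices, of
  \<open>dY = (B Y\<^sub>- + Y\<^sub>- B\<^sup>*) dt + A (C + Y\<^sub>-)\<^sup>1\<^sup>/\<^sup>2 d[L,L]\<^sup>d (C + Y\<^sub>-)\<^sup>1\<^sup>/\<^sup>2 A\<^sup>*\<close>.
  The initial value is \<open>Y 0\<close>, which is \<open>F 0\<close>-measurable by adaptedness.\<close>

definition mucogarch_volatility ::
  "real ^ 'n ^ 'n \<Rightarrow> real ^ 'n ^ 'n \<Rightarrow> real ^ 'n ^ 'n \<Rightarrow>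
     (real \<Rightarrow> 'a \<Rightarrow> real ^ 'n) \<Rightarrow> (real \<Rightarrow> 'a \<Rightarrow> real ^ 'n ^ 'n) \<Rightarrow> bool" where
  "mucogarch_volatility A B C L Y \<longleftrightarrow>
     adapted Y \<and>
     (AE \<omega> in M. cadlag (\<lambda>t. Y t \<omega>)) \<and>
     (AE \<omega> in M. \<forall>t\<ge>0. pos_semidef (Y t \<omega>)) \<and>
     (AE \<omega> in M. \<forall>t\<ge>0.
        let Yleft = left_limit (\<lambda>s. Y s \<omega>) in
        has_matrix_stieltjes_integral
          (\<lambda>s. A ** mat_sqrt (C + Yleft s))
          (jump_quad_var (\<lambda>s. L s \<omega>))
          (\<lambda>s. mat_sqrt (C + Yleft s) ** transpose A)
          0 t
          (Y t \<omega> - Y 0 \<omega> - (LINT s:{0..t}|lborel. B ** Yleft s + Yleft s ** transpose B)))"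

end

end

(*
  A path of Y satisfies |Y_t| + |C| <= y_0 + integral over (0,t] of (|Y_{s-}| + |C|) dW_s, where
  W_t = a (t + sum of |Delta L_s|^2 over s <= t). The increasing function
  u_t = u_0 exp (a t) * (product over s <= t of 1 + a |Delta L_s|^2) satisfies
  u_t >= u_s (1 + W_t - W_s), so a comparison argument gives |Y_t| + |C| < u_t if u_0 > y_0.
  The product over the jumps in (0,N] is at most the liminf of the products of 1 + a |increment of L|^2
  over the dyadic grids, whose factors are independent of each other and of Y_0. By Fatou's lemma it
  remains to see that E (1 + a |L_h|^2)^k <= 1 + K h for h = 2^-n. This follows from
  E (L_h)_i^j = O(h), which is proved by induction on j from L_{2h} = L_h + (L_{2h} - L_h).
*)

theory Submission
  imports Defs
begin

section \<open>Square roots of positive definite matrices\<close>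

text \<open>Two obstacles shape the argument. The sum \<open>jump_quad_var\<close> is an
  \<open>infsum\<close>, which is 0 when it diverges, so summability of the squared jumps has to be
  proved: it holds on almost every path because the jump products are bounded there by an almost
  surely finite \<open>liminf\<close>. That \<open>liminf\<close> is also a measurable majorant
  valid for all times up to \<open>N\<close> at once, which gives integrability and local
  boundedness together. Secondly, the integrals are defined through an unspecified decomposition
  into monotone functions. Left-endpoint Riemann sums remove it, since they involve only increments
  of the integrator; they need left-continuous integrands, hence continuity of the matrix square
  root. Adding \<open>norm C\<close> makes the growth estimate homogeneous, because the two roots
  around a jump together contribute a multiple of \<open>norm (C + Y)\<close>, which is at most
  \<open>norm C + norm Y\<close>. The strict inequality at time 0 leaves room for the Riemann
  error.\<close>

lemma bounded_bilinear_matrix_mult: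
  "bounded_bilinear ((**) :: real ^ 'n ^ 'm \<Rightarrow> real ^ 'p ^ 'n \<Rightarrow> real ^ 'p ^ 'm)"
proof -
  have "bilinear ((**) :: real ^ 'n ^ 'm \<Rightarrow> real ^ 'p ^ 'n \<Rightarrow> real ^ 'p ^ 'm)"
    by (auto simp: bilinear_def linear_iff matrix_matrix_mult_def vec_eq_iff sum.distrib
        scaleR_sum_right algebra_simps sum_distrib_left)
  then show ?thesis
    by (simp add: bilinear_conv_bounded_bilinear)
qed

lemma bounded_bilinear_matrix_vector_mult:
  "bounded_bilinear ((*v) :: real ^ 'n ^ 'm \<Rightarrow> real ^ 'n \<Rightarrow> real ^ 'm)"
proof -
  have "bilinear ((*v) :: real ^ 'n ^ 'm \<Rightarrow> real ^ 'n \<Rightarrow> real ^ 'm)"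
    by (auto simp: bilinear_def linear_iff matrix_vector_mult_def vec_eq_iff sum.distrib
        scaleR_sum_right algebra_simps sum_distrib_left)
  then show ?thesis
    by (simp add: bilinear_conv_bounded_bilinear)
qed

lemma continuous_on_matrix_mult [continuous_intros]:
  fixes f :: "'a :: topological_space \<Rightarrow> real ^ 'n ^ 'm" and g :: "'a \<Rightarrow> real ^ 'p ^ 'n"
  shows "continuous_on S f \<Longrightarrow> continuous_on S g \<Longrightarrow> continuous_on S (\<lambda>x. f x ** g x)"
  by (rule bounded_bilinear.continuous_on[OF bounded_bilinear_matrix_mult])

lemma continuous_on_matrix_vector_mult [continuous_intros]:
  fixes f :: "'a :: topological_space \<Rightarrow> real ^ 'n ^ 'm" and g :: "'a \<Rightarrow> real ^ 'n"
  shows "continuous_on S f \<Longrightarrow> continuous_on S g \<Longrightarrow> continuous_on S (\<lambda>x. f x *v g x)"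
  by (rule bounded_bilinear.continuous_on[OF bounded_bilinear_matrix_vector_mult])

lemma continuous_on_transpose [continuous_intros]:
  fixes f :: "'a :: topological_space \<Rightarrow> real ^ 'n ^ 'm"
  assumes "continuous_on S f"
  shows "continuous_on S (\<lambda>x. transpose (f x))"
  unfolding transpose_def by (intro continuous_intros assms)

lemma norm_transpose: "norm (transpose M) = norm (M :: real ^ 'n ^ 'm)"
proof -
  have "(\<Sum>i\<in>UNIV. \<Sum>j\<in>UNIV. (M $ j $ i)\<^sup>2) = (\<Sum>i\<in>UNIV. \<Sum>j\<in>UNIV. (M $ i $ j)\<^sup>2)"
    by (rule sum.swap)
  then show ?thesis
    by (simp add: norm_vec_def L2_set_def transpose_def sum_nonneg)
qed

text \<open>By symmetry of \<open>Y\<close>, the rows of \<open>Z ** Y\<close> are the images under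
  \<open>Y\<close> of the rows of \<open>Z\<close>, and \<open>norm\<close> is the Frobenius norm,
  built from the row norms. An operator bound on \<open>Y\<close> is essential for the contraction
  below: a matrix of operator norm less than 1 can have Frobenius norm above 1.\<close>

lemma norm_mult_symmetric_le:
  fixes Z :: "real ^ 'n ^ 'm" and Y :: "real ^ 'n ^ 'n"
  assumes "symmetric_matrix Y" "\<And>v. norm (Y *v v) \<le> q * norm v" "0 \<le> q"
  shows "norm (Z ** Y) \<le> q * norm Z"
proof -
  have row: "(Z ** Y) $ i = Y *v (Z $ i)" for i
  proof -
    have "(Z ** Y) $ i $ j = (transpose Y *v (Z $ i)) $ j" for j
      by (simp add: matrix_matrix_mult_def matrix_vector_mult_def transpose_def mult.commute)
    then have "(Z ** Y) $ i = transpose Y *v (Z $ i)"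
      unfolding vec_eq_iff by blast
    moreover have "transpose Y = Y"
      using assms(1) by (simp add: symmetric_matrix_def)
    ultimately show ?thesis by (simp only:)
  qed
  have "norm (Z ** Y) \<le> L2_set (\<lambda>i. q * norm (Z $ i)) UNIV"
    unfolding norm_vec_def[of "Z ** Y"] by (intro L2_set_mono) (auto simp: row assms(2))
  also have "\<dots> = q * norm Z"
    using assms(3) by (simp add: L2_set_right_distrib norm_vec_def)
  finally show ?thesis .
qed

lemma norm_symmetric_mult_le:
  fixes Z :: "real ^ 'm ^ 'n" and Y :: "real ^ 'n ^ 'n"
  assumes "symmetric_matrix Y" "\<And>v. norm (Y *v v) \<le> q * norm v" "0 \<le> q"
  shows "norm (Y ** Z) \<le> q * norm Z"
proof -
  have "norm (Y ** Z) = norm (transpose Z ** Y)"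
    using assms(1) norm_transpose[of "Y ** Z"]
    by (simp add: matrix_transpose_mul symmetric_matrix_def)
  also have "\<dots> \<le> q * norm (transpose Z)"
    by (rule norm_mult_symmetric_le[OF assms])
  finally show ?thesis by (simp add: norm_transpose)
qed

text \<open>The form attains a positive minimum on the compact unit sphere; homogeneity of degree 2
  carries it to all \<open>v\<close>.\<close>

lemma pos_def_coercive:
  fixes X :: "real ^ 'n ^ 'n"
  assumes "pos_def X"
  obtains e where "e > 0" "\<And>v. e * (norm v)\<^sup>2 \<le> v \<bullet> (X *v v)"
proof -
  have "continuous_on (sphere 0 1) (\<lambda>v. v \<bullet> (X *v v))"
    by (intro continuous_intros)
  moreover have "sphere (0 :: real ^ 'n) 1 \<noteq> {}"
    by simp
  ultimately have "\<exists>w\<in>sphere 0 1. \<forall>v\<in>sphere 0 1. w \<bullet> (X *v w) \<le> v \<bullet> (X *v v)"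
    by (intro continuous_attains_inf compact_sphere)
  then obtain w where w: "w \<in> sphere 0 1"
      "\<And>v. v \<in> sphere 0 1 \<Longrightarrow> w \<bullet> (X *v w) \<le> v \<bullet> (X *v v)"
    by blast
  show ?thesis
  proof (rule that)
    show "w \<bullet> (X *v w) > 0"
      using assms w(1) unfolding pos_def_def by (metis mem_sphere_0 norm_zero zero_neq_one)
    show "w \<bullet> (X *v w) * (norm v)\<^sup>2 \<le> v \<bullet> (X *v v)" for v
    proof (cases "v = 0")
      case False
      define u where "u = v /\<^sub>R norm v"
      have "w \<bullet> (X *v w) \<le> u \<bullet> (X *v u)"
        using False by (intro w(2)) (simp add: u_def)
      moreover have "v = norm v *\<^sub>R u"
        using False by (simp add: u_def)
      then have "v \<bullet> (X *v v) = (norm v)\<^sup>2 * (u \<bullet> (X *v u))"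
        by (metis (no_types, opaque_lifting) inner_commute inner_scaleR_left matrix_vector_mult_scaleR
            mult.assoc power2_eq_square)
      ultimately show ?thesis
        by (simp add: mult.commute[of "(norm v)\<^sup>2"] mult_right_mono)
    qed simp
  qed
qed

lemma pos_def_add_pos_semidef: "pos_def X \<Longrightarrow> pos_semidef Y \<Longrightarrow> pos_def (X + Y)"
  by (auto simp: pos_def_def pos_semidef_def symmetric_matrix_def transpose_def vec_eq_iff
      matrix_vector_mult_add_rdistrib inner_add_right add_pos_nonneg)

text \<open>Lets positive semidefiniteness pass to left limits of \<open>Y\<close> and to
  subsequential limits of square roots.\<close>

lemma closed_pos_semidef: "closed {X :: real ^ 'n ^ 'n. pos_semidef X}"
  unfolding pos_semidef_def symmetric_matrix_def
  by (intro closed_Collect_conj closed_Collect_all closed_Collect_eq closed_Collect_le continuous_intros)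

text \<open>With \<open>c\<close> small, \<open>T = 1 - c X\<close> has operator norm \<open>q < 1\<close>, and a fixed point \<open>Y\<close> of the
  contraction \<open>Y \<mapsto> (T + Y\<^sup>2) / 2\<close> satisfies \<open>(1 - Y)\<^sup>2 = c X\<close>.\<close>

lemma pos_def_has_sqrt:
  fixes X :: "real ^ 'n ^ 'n"
  assumes "pos_def X"
  shows "\<exists>R. pos_semidef R \<and> R ** R = X"
proof -
  obtain e where e: "e > 0" "\<And>v. e * (norm v)\<^sup>2 \<le> v \<bullet> (X *v v)"
    using pos_def_coercive[OF assms] by blast
  obtain K0 where K0: "K0 > 0" "\<And>v. norm (X *v v) \<le> norm v * K0"
    using bounded_linear.pos_bounded[OF bounded_bilinear.bounded_linear_right[OF
        bounded_bilinear_matrix_vector_mult, of X]] by blast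
  \<comment> \<open>Taking \<open>K\<close> at least \<open>e\<close> keeps \<open>e^2 / K^2\<close>
    at most 1, so the square root \<open>q\<close> below is real.\<close>
  define K where "K = max K0 e"
  have K: "K > 0" "e \<le> K"
    using K0(1) by (auto simp: K_def)
  have XK: "norm (X *v v) \<le> K * norm v" for v
  proof -
    have "norm v * K0 \<le> norm v * K"
      by (intro mult_left_mono) (auto simp: K_def)
    then show ?thesis using K0(2)[of v] by (simp add: mult.commute)
  qed
  \<comment> \<open>This value minimises \<open>1 - 2 * c * e + c^2 * K^2\<close>, the bound for the
    squared operator norm of \<open>T\<close>; the minimum is \<open>1 - e^2 / K^2\<close>.\<close>
  define c where "c = e / K\<^sup>2"
  have c: "c > 0" using e(1) K(1) by (simp add: c_def)
  define q where "q = sqrt (1 - e\<^sup>2 / K\<^sup>2)"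
  have eK: "e\<^sup>2 / K\<^sup>2 \<le> 1" "e\<^sup>2 / K\<^sup>2 > 0"
    using e(1) K(1,2) by (auto simp: power_mono)
  have q: "0 \<le> q" "q < 1" "q\<^sup>2 = 1 - e\<^sup>2 / K\<^sup>2"
    using eK by (auto simp: q_def)
  define T where "T = mat 1 - c *\<^sub>R X"
  have symX: "transpose X = X"
    using assms by (simp add: pos_def_def symmetric_matrix_def)
  have symT: "transpose T = T"
    using symX by (simp add: T_def transpose_def vec_eq_iff mat_def)
  have Tv: "T *v v = v - c *\<^sub>R (X *v v)" for v
    by (simp add: T_def matrix_vector_mult_diff_rdistrib scaleR_matrix_vector_assoc)
  have Tq: "norm (T *v v) \<le> q * norm v" for v
  proof -
    have "(norm (T *v v))\<^sup>2 = (norm v)\<^sup>2 - 2 * c * (v \<bullet> (X *v v)) + c\<^sup>2 * (norm (X *v v))\<^sup>2"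
      unfolding Tv power2_norm_eq_inner
      by (simp add: inner_diff inner_commute algebra_simps power2_eq_square)
    also have "\<dots> \<le> (norm v)\<^sup>2 - 2 * c * (e * (norm v)\<^sup>2) + c\<^sup>2 * (K * norm v)\<^sup>2"
      using c e(2)[of v] XK[of v] by (intro add_mono diff_mono mult_left_mono power_mono) auto
    also have "\<dots> = (1 - 2 * (c * e) + c\<^sup>2 * K\<^sup>2) * (norm v)\<^sup>2"
      by (simp add: algebra_simps)
    also have "c * e = e\<^sup>2 / K\<^sup>2"
      by (simp add: c_def power2_eq_square)
    also have "c\<^sup>2 * K\<^sup>2 = e\<^sup>2 / K\<^sup>2"
      using K(1) by (simp add: c_def power2_eq_square)
    also have "(1 - 2 * (e\<^sup>2 / K\<^sup>2) + e\<^sup>2 / K\<^sup>2) * (norm v)\<^sup>2 = (q * norm v)\<^sup>2"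
      by (simp add: power_mult_distrib q(3))
    finally show ?thesis
      by (rule power2_le_imp_le) (simp add: q)
  qed
  \<comment> \<open>A complete set that \<open>f\<close> maps into itself: symmetry of
    \<open>T\<close> and \<open>Y\<close> passes to \<open>f Y\<close>, and the operator bound
    survives because \<open>(q + q * q) / 2\<close> is at most \<open>q\<close>.\<close>
  define S where "S = {Y :: real ^ 'n ^ 'n. symmetric_matrix Y \<and> (\<forall>v. norm (Y *v v) \<le> q * norm v)}"
  define f where "f Y = (1/2) *\<^sub>R (T + Y ** Y)" for Y :: "real ^ 'n ^ 'n"
  have "closed S"
    unfolding S_def symmetric_matrix_def
    by (intro closed_Collect_conj closed_Collect_all closed_Collect_eq closed_Collect_le continuous_intros)
  note complete_S = complete_eq_closed[THEN iffD2, OF this]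
  have "S \<noteq> {}"
    using symT Tq by (auto simp: S_def symmetric_matrix_def)
  moreover have "f ` S \<subseteq> S"
  proof (rule image_subsetI)
    fix Y assume Y: "Y \<in> S"
    have "transpose (f Y) = (1/2) *\<^sub>R (transpose T + transpose (Y ** Y))"
      by (simp add: f_def transpose_def vec_eq_iff)
    then have "transpose (f Y) = f Y"
      using Y symT by (simp add: matrix_transpose_mul f_def S_def symmetric_matrix_def)
    moreover have "norm (f Y *v v) \<le> q * norm v" for v
    proof -
      have "norm (Y *v (Y *v v)) \<le> q * norm (Y *v v)"
        using Y by (simp add: S_def)
      also have "\<dots> \<le> q * (q * norm v)"
        using Y q(1) by (intro mult_left_mono) (auto simp: S_def)
      also have "\<dots> \<le> 1 * (q * norm v)"
        using q by (intro mult_right_mono) auto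
      finally have "norm (T *v v + Y *v (Y *v v)) \<le> 2 * (q * norm v)"
        using norm_triangle_ineq[of "T *v v" "Y *v (Y *v v)"] Tq[of v] by linarith
      moreover have "f Y *v v = (1/2) *\<^sub>R (T *v v + Y *v (Y *v v))"
        by (simp add: f_def scaleR_matrix_vector_assoc[symmetric] matrix_vector_mult_add_rdistrib
            matrix_vector_mul_assoc)
      ultimately show ?thesis by simp
    qed
    ultimately show "f Y \<in> S" by (simp add: S_def symmetric_matrix_def)
  qed
  moreover have "dist (f Y) (f Z) \<le> q * dist Y Z" if "Y \<in> S" "Z \<in> S" for Y Z
  proof -
    \<comment> \<open>The difference of squares is split without commutativity; each summand has one
      factor of operator norm at most \<open>q\<close>.\<close>
    have "f Y - f Z = (1/2) *\<^sub>R (Y ** (Y - Z) + (Y - Z) ** Z)"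
      by (simp add: f_def bounded_bilinear.diff_left[OF bounded_bilinear_matrix_mult]
          bounded_bilinear.diff_right[OF bounded_bilinear_matrix_mult] algebra_simps)
    moreover have "norm (Y ** (Y - Z)) \<le> q * norm (Y - Z)"
      using that q(1) by (intro norm_symmetric_mult_le) (auto simp: S_def)
    moreover have "norm ((Y - Z) ** Z) \<le> q * norm (Y - Z)"
      using that q(1) by (intro norm_mult_symmetric_le) (auto simp: S_def)
    ultimately show ?thesis
      using norm_triangle_ineq[of "Y ** (Y - Z)" "(Y - Z) ** Z"] by (simp add: dist_norm)
  qed
  ultimately have "\<exists>!Y. Y \<in> S \<and> f Y = Y"
    using q(1,2) by (intro Banach_fix[OF complete_S, where c = q]) auto
  then obtain Y where Y: "Y \<in> S" "f Y = Y"
    by blast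
  define R where "R = (1 / sqrt c) *\<^sub>R (mat 1 - Y)"
  have "T + Y ** Y = 2 *\<^sub>R Y"
    using arg_cong[OF Y(2), of "\<lambda>Z. 2 *\<^sub>R Z"] by (simp add: f_def)
  then have YY: "Y ** Y = 2 *\<^sub>R Y - T"
    by (metis add_diff_cancel_left')
  have "(mat 1 - Y) ** (mat 1 - Y) = mat 1 - Y - Y + Y ** Y"
    by (simp add: bounded_bilinear.diff_left[OF bounded_bilinear_matrix_mult]
          bounded_bilinear.diff_right[OF bounded_bilinear_matrix_mult])
  also have "\<dots> = c *\<^sub>R X"
    unfolding YY by (simp add: T_def scaleR_2)
  finally have "R ** R = X"
    using c by (simp add: R_def bounded_bilinear.scaleR_left[OF bounded_bilinear_matrix_mult]
          bounded_bilinear.scaleR_right[OF bounded_bilinear_matrix_mult])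
  moreover have "symmetric_matrix R"
    using Y(1) by (simp add: R_def S_def symmetric_matrix_def transpose_def vec_eq_iff mat_def)
  moreover have "0 \<le> v \<bullet> (R *v v)" for v
  proof -
    have "v \<bullet> (Y *v v) \<le> norm v * norm (Y *v v)"
      by (rule norm_cauchy_schwarz)
    also have "norm (Y *v v) \<le> q * norm v"
      using Y(1) by (simp add: S_def)
    also have "\<dots> \<le> 1 * norm v"
      using q by (intro mult_right_mono) auto
    finally have "v \<bullet> (Y *v v) \<le> v \<bullet> v"
      by (simp add: dot_square_norm power2_eq_square mult_left_mono)
    moreover have "R *v v = (1 / sqrt c) *\<^sub>R (v - Y *v v)"
      by (simp add: R_def scaleR_matrix_vector_assoc[symmetric] matrix_vector_mult_diff_rdistrib)
    ultimately show ?thesis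
      using c by (simp add: inner_diff_right)
  qed
  ultimately show ?thesis by (auto simp: pos_semidef_def)
qed

lemma trace_symmetric_sandwich:
  fixes D R :: "real ^ 'n ^ 'n"
  assumes "symmetric_matrix D"
  shows "trace (D ** (R ** D)) = (\<Sum>i\<in>UNIV. (D $ i) \<bullet> (R *v (D $ i)))"
proof -
  have D: "D $ i $ j = D $ j $ i" for i j
    using assms by (auto simp: symmetric_matrix_def transpose_def vec_eq_iff)
  show ?thesis
    unfolding trace_def matrix_matrix_mult_def matrix_vector_mult_def inner_vec_def
    by (simp add: D)
qed

text \<open>Moving from \<open>v\<close> by \<open>t\<close> in the direction
  \<open>w = R *v v\<close> changes the form by \<open>2 * t * p + t^2 * s\<close>. If
  \<open>w\<close> were nonzero, the linear term would make this negative for small negative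
  \<open>t\<close>.\<close>

lemma pos_semidef_quadratic_form_eq_0:
  fixes R :: "real ^ 'n ^ 'n"
  assumes "pos_semidef R" "v \<bullet> (R *v v) = 0"
  shows "R *v v = 0"
proof (rule ccontr)
  assume "R *v v \<noteq> 0"
  define w where "w = R *v v"
  define p where "p = w \<bullet> w"
  define s where "s = w \<bullet> (R *v w)"
  \<comment> \<open>The minimiser would be \<open>- p / s\<close>; the added 1 covers
    \<open>s = 0\<close> and still gives a negative value.\<close>
  define t where "t = - p / (s + 1)"
  have p: "p > 0" using \<open>R *v v \<noteq> 0\<close> by (simp add: p_def w_def)
  have s: "s \<ge> 0" using assms(1) by (simp add: s_def pos_semidef_def)
  have R: "transpose R = R" using assms(1) by (simp add: pos_semidef_def symmetric_matrix_def)
  have "0 \<le> (v + t *\<^sub>R w) \<bullet> (R *v (v + t *\<^sub>R w))"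
    using assms(1) by (simp add: pos_semidef_def)
  also have "\<dots> = 2 * t * p + t\<^sup>2 * s"
  proof -
    have "v \<bullet> (R *v w) = p"
      using dot_lmul_matrix[of v R w] transpose_matrix_vector[of R v] by (simp add: p_def w_def R)
    then show ?thesis
      using assms(2) by (simp add: matrix_vector_right_distrib matrix_vector_mult_scaleR inner_add
          s_def p_def w_def[symmetric] power2_eq_square algebra_simps)
  qed
  also have "p = - t * (s + 1)"
    using s by (simp add: t_def)
  also have "2 * t * (- t * (s + 1)) + t\<^sup>2 * s = t\<^sup>2 * (s - 2 * (s + 1))"
    by (simp add: algebra_simps power2_eq_square)
  also have "\<dots> < 0"
    using p s by (intro mult_pos_neg) (auto simp: t_def)
  finally show False by simp
qed

text \<open>If \<open>R\<^sup>2 = S\<^sup>2\<close> and \<open>D = R - S\<close>, then \<open>R D + D S = 0\<close>; the traces of \<open>D R D\<close> and \<open>D S D\<close> are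
  nonnegative with sum \<open>0\<close>, so \<open>\<langle>d, R d\<rangle> = \<langle>d, S d\<rangle> = 0\<close> for all rows \<open>d\<close> of \<open>D\<close>.\<close>

lemma pos_semidef_sqrt_unique:
  fixes R S :: "real ^ 'n ^ 'n"
  assumes "pos_semidef R" "pos_semidef S" "R ** R = S ** S"
  shows "R = S"
proof -
  define D where "D = R - S"
  have symR: "transpose R = R" and symS: "transpose S = S"
    using assms(1,2) by (auto simp: pos_semidef_def symmetric_matrix_def)
  have symD: "symmetric_matrix D"
    using symR symS by (simp add: D_def symmetric_matrix_def transpose_def vec_eq_iff)
  have D_entry: "D $ i $ j = D $ j $ i" for i j
    using symD by (auto simp: symmetric_matrix_def transpose_def vec_eq_iff)
  have "R ** D + D ** S = 0"
    using assms(3) by (simp add: D_def bounded_bilinear.diff_left[OF bounded_bilinear_matrix_mult]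
          bounded_bilinear.diff_right[OF bounded_bilinear_matrix_mult])
  then have "trace (D ** (R ** D) + D ** (D ** S)) = 0"
    by (simp add: trace_def flip: matrix_add_ldistrib)
  moreover have "trace (D ** (D ** S)) = trace (D ** (S ** D))"
    using trace_mul_sym[of D "D ** S"] by (simp add: matrix_mul_assoc)
  ultimately have sum0: "(\<Sum>i\<in>UNIV. (D $ i) \<bullet> (R *v (D $ i))) + (\<Sum>i\<in>UNIV. (D $ i) \<bullet> (S *v (D $ i))) = 0"
    by (simp add: trace_add trace_symmetric_sandwich[OF symD])
  have posR: "0 \<le> (D $ i) \<bullet> (R *v (D $ i))" and posS: "0 \<le> (D $ i) \<bullet> (S *v (D $ i))" for i
    using assms(1,2) by (auto simp: pos_semidef_def)
  have "(\<Sum>i\<in>UNIV. (D $ i) \<bullet> (R *v (D $ i))) = 0" "(\<Sum>i\<in>UNIV. (D $ i) \<bullet> (S *v (D $ i))) = 0"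
    using sum0 sum_nonneg[of UNIV "\<lambda>i. (D $ i) \<bullet> (R *v (D $ i))"]
      sum_nonneg[of UNIV "\<lambda>i. (D $ i) \<bullet> (S *v (D $ i))"] posR posS by auto
  then have "(D $ i) \<bullet> (R *v (D $ i)) = 0" "(D $ i) \<bullet> (S *v (D $ i)) = 0" for i
    using posR posS by (auto simp: sum_nonneg_eq_0_iff)
  then have "R *v (D $ i) = 0" "S *v (D $ i) = 0" for i
    using pos_semidef_quadratic_form_eq_0 assms(1,2) by blast+
  \<comment> \<open>\<open>R\<close> and \<open>S\<close> annihilate every row of \<open>D\<close>,
    hence so does \<open>D\<close>; entry \<open>i\<close> of the image of row \<open>i\<close> is
    the squared length of that row.\<close>
  then have "D *v (D $ i) = 0" for i
    by (simp add: D_def matrix_vector_mult_diff_rdistrib)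
  moreover have "(D *v (D $ i)) $ i = (D $ i) \<bullet> (D $ i)" for i
    by (simp add: matrix_vector_mult_def inner_vec_def)
  ultimately have "D $ i = 0" for i
    by (metis inner_eq_zero_iff zero_index)
  then have "D = 0" by (simp add: vec_eq_iff)
  then show ?thesis by (simp add: D_def)
qed

text \<open>Existence and uniqueness together make the definite description \<open>mat_sqrt\<close>
  usable. The equation only takes roots of \<open>C\<close> plus a positive semidefinite matrix, so
  the positive definite case suffices.\<close>

lemma mat_sqrt_pos_def:
  assumes "pos_def X"
  shows pos_semidef_mat_sqrt: "pos_semidef (mat_sqrt X)"
    and mat_sqrt_square: "mat_sqrt X ** mat_sqrt X = X"
proof -
  obtain R where R: "pos_semidef R" "R ** R = X"
    using pos_def_has_sqrt[OF assms] by blast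
  have "\<exists>!R. pos_semidef R \<and> R ** R = X"
    using R pos_semidef_sqrt_unique by (intro ex1I[of _ R]) auto
  then have "pos_semidef (mat_sqrt X) \<and> mat_sqrt X ** mat_sqrt X = X"
    unfolding mat_sqrt_def by (rule theI')
  then show "pos_semidef (mat_sqrt X)" "mat_sqrt X ** mat_sqrt X = X" by auto
qed

text \<open>With \<open>R = mat_sqrt X\<close> symmetric, the squared Frobenius norm of
  \<open>R\<close> is the trace of \<open>R ** R = X\<close>. Thus two roots together grow only
  linearly in \<open>X\<close>, which keeps the equation within reach of a linear
  comparison.\<close>

lemma norm_mat_sqrt:
  fixes X :: "real ^ 'n ^ 'n"
  assumes "pos_def X"
  shows "(norm (mat_sqrt X))\<^sup>2 \<le> real CARD('n) * norm X"
proof -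
  define R where "R = mat_sqrt X"
  have sym: "R $ i $ j = R $ j $ i" for i j
    using pos_semidef_mat_sqrt[OF assms]
    by (auto simp: R_def pos_semidef_def symmetric_matrix_def transpose_def vec_eq_iff)
  have "(norm R)\<^sup>2 = (\<Sum>i\<in>UNIV. \<Sum>j\<in>UNIV. (R $ i $ j)\<^sup>2)"
    by (simp add: norm_vec_def L2_set_def sum_nonneg)
  also have "\<dots> = (\<Sum>i\<in>UNIV. (R ** R) $ i $ i)"
    by (simp add: matrix_matrix_mult_def power2_eq_square sym)
  also have "\<dots> = (\<Sum>i\<in>UNIV. X $ i $ i)"
    by (simp add: R_def mat_sqrt_square[OF assms])
  also have "\<dots> \<le> (\<Sum>i\<in>(UNIV :: 'n set). norm X)"
  proof (rule sum_mono)
    fix i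
    have "X $ i $ i \<le> norm (X $ i)"
      using component_le_norm_cart[of "X $ i" i] by simp
    also have "\<dots> \<le> norm X"
      by (rule Finite_Cartesian_Product.norm_nth_le)
    finally show "X $ i $ i \<le> norm X" .
  qed
  finally show ?thesis by (simp add: R_def)
qed

text \<open>Compactness and uniqueness: the roots stay in a ball, and the limit of any convergent
  subsequence is positive semidefinite with square \<open>Z\<close>, so it is
  \<open>mat_sqrt Z\<close>.\<close>

lemma tendsto_mat_sqrt:
  fixes X :: "nat \<Rightarrow> real ^ 'n ^ 'n"
  assumes X: "\<And>n. pos_def (X n)" and Z: "pos_def Z" and lim: "X \<longlonglongrightarrow> Z"
  shows "(\<lambda>n. mat_sqrt (X n)) \<longlonglongrightarrow> mat_sqrt Z"
proof -
  obtain K where K: "\<And>n. norm (X n) \<le> K"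
    using convergent_imp_Bseq[of X] lim by (auto simp: convergent_def Bseq_def)
  define c where "c = cball (0 :: real ^ 'n ^ 'n) (sqrt (real CARD('n) * K))"
  have "mat_sqrt (X n) \<in> c" for n
  proof -
    have "(norm (mat_sqrt (X n)))\<^sup>2 \<le> real CARD('n) * K"
      by (intro order_trans[OF norm_mat_sqrt[OF X]] mult_left_mono K) auto
    then show ?thesis
      by (simp add: c_def real_le_rsqrt)
  qed
  have unique: "R = mat_sqrt Z"
    if r: "strict_mono (r :: nat \<Rightarrow> nat)" and R: "(\<lambda>n. mat_sqrt (X (r n))) \<longlonglongrightarrow> R" for r R
  proof -
    have "(\<lambda>n. mat_sqrt (X (r n)) ** mat_sqrt (X (r n))) \<longlonglongrightarrow> R ** R"
      by (intro bounded_bilinear.tendsto[OF bounded_bilinear_matrix_mult] R)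
    moreover have "(\<lambda>n. X (r n)) \<longlonglongrightarrow> Z"
      using LIMSEQ_subseq_LIMSEQ[OF lim r] by (simp add: o_def)
    ultimately have "R ** R = Z"
      by (simp add: mat_sqrt_square[OF X] LIMSEQ_unique)
    moreover have "R \<in> {X. pos_semidef X}"
      by (rule closed_sequentially[OF closed_pos_semidef _ R]) (simp add: pos_semidef_mat_sqrt[OF X])
    ultimately show ?thesis
      using pos_semidef_sqrt_unique[of R "mat_sqrt Z"] mat_sqrt_pos_def[OF Z] by simp
  qed
  show ?thesis
  proof (rule tendstoI, rule ccontr)
    fix e :: real
    assume "e > 0" and "\<not> (\<forall>\<^sub>F n in sequentially. dist (mat_sqrt (X n)) (mat_sqrt Z) < e)"
    then obtain r :: "nat \<Rightarrow> nat"
      where r: "strict_mono r" "\<And>n. \<not> dist (mat_sqrt (X (r n))) (mat_sqrt Z) < e"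
      using not_eventually_sequentiallyD by blast
    have "seq_compact c"
      by (simp add: c_def compact_imp_seq_compact)
    then obtain R r' where r': "strict_mono r'" "((\<lambda>n. mat_sqrt (X (r n))) \<circ> r') \<longlonglongrightarrow> R"
      using \<open>\<And>n. mat_sqrt (X n) \<in> c\<close> unfolding seq_compact_def by meson
    have "R = mat_sqrt Z"
      using unique[of "r \<circ> r'" R] r(1) r' strict_mono_o[OF r(1) r'(1)] by (simp add: o_def)
    then have "\<forall>\<^sub>F n in sequentially. dist (mat_sqrt (X (r (r' n)))) (mat_sqrt Z) < e"
      using tendstoD[OF r'(2) \<open>e > 0\<close>] by (simp add: o_def)
    then show False
      using r(2) by (auto simp: eventually_sequentially)
  qed
qed

section \<open>Cadlag paths\<close>

lemma filterlim_at_left_sequentiallyI: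
  fixes s :: "'b :: linorder_topology"
  assumes "S \<longlonglongrightarrow> s" "\<And>n. S n < s"
  shows "filterlim S (at_left s) sequentially"
  unfolding filterlim_at using assms(1)
  by (intro conjI always_eventually allI) (simp_all add: assms(2) less_imp_neq)

lemma tendsto_left_limit:
  fixes f :: "real \<Rightarrow> 'b :: t2_space"
  assumes "cadlag f" "0 < t"
  shows "(f \<longlongrightarrow> left_limit f t) (at_left t)"
proof -
  obtain l where "(f \<longlongrightarrow> l) (at_left t)"
    using assms by (auto simp: cadlag_def)
  moreover have "Lim (at_left t) f = l"
    by (rule tendsto_Lim[OF _ calculation]) simp
  ultimately show ?thesis using assms(2) by (simp add: left_limit_def)
qed

text \<open>For \<open>s\<close> slightly below \<open>t\<close>, \<open>left_limit f s\<close> is a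
  limit of values within \<open>e / 2\<close> of \<open>left_limit f t\<close>; passing to the limit
  costs only the strictness. This is the regularity of the integrands on which the Riemann sums
  rely.\<close>

lemma left_limit_left_continuous:
  fixes f :: "real \<Rightarrow> 'b :: metric_space"
  assumes "cadlag f" "0 < t"
  shows "(left_limit f \<longlongrightarrow> left_limit f t) (at_left t)"
proof (rule tendstoI)
  fix e :: real assume "e > 0"
  then have "\<forall>\<^sub>F s in at_left t. dist (f s) (left_limit f t) < e / 2"
    using tendstoD[OF tendsto_left_limit[OF assms]] half_gt_zero by blast
  then obtain b where b: "b < t" "\<And>s. b < s \<Longrightarrow> s < t \<Longrightarrow> dist (f s) (left_limit f t) < e / 2"
    by (auto simp: eventually_at_left[OF assms(2)])
  have "dist (left_limit f s) (left_limit f t) < e" if "max b 0 < s" "s < t" for s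
  proof -
    have "((\<lambda>r. dist (f r) (left_limit f t)) \<longlongrightarrow> dist (left_limit f s) (left_limit f t)) (at_left s)"
      using that by (intro tendsto_intros tendsto_left_limit assms(1)) auto
    moreover have "\<forall>\<^sub>F r in at_left s. dist (f r) (left_limit f t) \<le> e / 2"
      using that b(2) by (auto simp: eventually_at_left[of b s] intro!: exI[of _ b] less_imp_le)
    ultimately have "dist (left_limit f s) (left_limit f t) \<le> e / 2"
      by (rule tendsto_upperbound) simp
    then show ?thesis using \<open>e > 0\<close> by simp
  qed
  then show "\<forall>\<^sub>F s in at_left t. dist (left_limit f s) (left_limit f t) < e"
    using b(1) assms(2) by (auto simp: eventually_at_left[OF assms(2)] intro!: exI[of _ "max b 0"])
qed

text \<open>By bisection, local boundedness is enough: to the right of a point the values are near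
  \<open>f x\<close>, to the left near the left limit.\<close>

lemma cadlag_bounded:
  fixes f :: "real \<Rightarrow> 'b :: real_normed_vector"
  assumes "cadlag f" "0 \<le> t"
  shows "bounded (f ` {0..t})"
proof -
  \<comment> \<open>The bisection principle also tests intervals that stick out of
    \<open>{0..t}\<close>; intersecting with \<open>T\<close> excludes negative times, where the
    path is uncontrolled.\<close>
  define T where "T = {0..t}"
  have "bounded (f ` ({0..t} \<inter> T))"
    using assms(2)
  proof (induction rule: Bolzano)
    case (trans a b c)
    have "{a..c} \<inter> T \<subseteq> ({a..b} \<inter> T) \<union> ({b..c} \<inter> T)" by auto
    then have "f ` ({a..c} \<inter> T) \<subseteq> f ` ({a..b} \<inter> T) \<union> f ` ({b..c} \<inter> T)"
      by (metis image_Un image_mono)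
    moreover have "bounded (f ` ({a..b} \<inter> T) \<union> f ` ({b..c} \<inter> T))"
      using trans(1,2) unfolding bounded_Un by (rule conjI)
    ultimately show ?case
      by (rule bounded_subset[rotated])
  next
    case (local x)
    have "\<forall>\<^sub>F s in at_right x. dist (f s) (f x) < 1"
      using assms(1) local by (intro tendstoD) (auto simp: cadlag_def)
    then obtain b where b: "b > x" "\<And>s. x < s \<Longrightarrow> s < b \<Longrightarrow> dist (f s) (f x) < 1"
      unfolding eventually_at_right[of x "x + 1", simplified] by blast
    obtain a l where a: "a < x" "\<And>s. 0 < x \<Longrightarrow> a < s \<Longrightarrow> s < x \<Longrightarrow> dist (f s) l < 1"
    proof (cases "x > 0")
      case True
      then have "\<forall>\<^sub>F s in at_left x. dist (f s) (left_limit f x) < 1"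
        using assms(1) by (intro tendstoD tendsto_left_limit) auto
      then show ?thesis
        using that unfolding eventually_at_left[OF True] by blast
    qed (use that[of "x - 1"] in auto)
    have sub: "f ` ({c..d} \<inter> T) \<subseteq> ball (f x) 1 \<union> ball l 1"
      if "c \<le> x" "x \<le> d" "d - c < min (b - x) (x - a)" for c d
    proof
      fix z assume "z \<in> f ` ({c..d} \<inter> T)"
      then obtain s where s: "z = f s" "c \<le> s" "s \<le> d" "0 \<le> s" by (auto simp: T_def)
      consider "s < x" | "s = x" | "s > x" by linarith
      then show "z \<in> ball (f x) 1 \<union> ball l 1"
        using that s a(2)[of s] b(2)[of s] by cases (auto simp: dist_commute)
    qed
    show ?case
    proof (intro exI[of _ "min (b - x) (x - a)"] conjI allI impI)
      show "0 < min (b - x) (x - a)" using a(1) b(1) by simp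
      show "bounded (f ` ({c..d} \<inter> T))" if "c \<le> x \<and> x \<le> d \<and> d - c < min (b - x) (x - a)" for c d
        using that by (intro bounded_subset[OF _ sub]) auto
    qed
  qed
  then show ?thesis by (simp add: T_def)
qed

lemma left_limit_in_closed:
  fixes f :: "real \<Rightarrow> 'b :: t2_space"
  assumes "cadlag f" "closed S" "0 \<le> t" "\<And>s. 0 \<le> s \<Longrightarrow> s \<le> t \<Longrightarrow> f s \<in> S"
  shows "left_limit f t \<in> S"
proof (cases "t = 0")
  case False
  then have "0 < t" using assms(3) by simp
  then have "\<forall>\<^sub>F s in at_left t. f s \<in> S"
    using assms(4) by (auto simp: eventually_at_left[of 0 t] intro!: exI[of _ 0])
  then show ?thesis
    by (rule Lim_in_closed_set[OF assms(2) _ _ tendsto_left_limit[OF assms(1) \<open>0 < t\<close>]]) simp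
qed (use assms in \<open>simp add: left_limit_def\<close>)

section \<open>Riemann sums for Stieltjes integrals\<close>

text \<open>The equidistant partition of \<open>{0..t}\<close> into \<open>n + 1\<close> cells, so
  that no \<open>n\<close> leads to a division by zero.\<close>

definition grid :: "real \<Rightarrow> nat \<Rightarrow> nat \<Rightarrow> real" where
  "grid t n i = t * real i / real (Suc n)"

lemma grid_0 [simp]: "grid t n 0 = 0"
  and grid_last [simp]: "grid t n (Suc n) = t"
  by (auto simp: grid_def)

lemma grid_mono: "0 \<le> t \<Longrightarrow> i \<le> j \<Longrightarrow> grid t n i \<le> grid t n j"
  by (simp add: grid_def divide_right_mono mult_left_mono)

lemma grid_bounds: "0 \<le> t \<Longrightarrow> i \<le> Suc n \<Longrightarrow> grid t n i \<in> {0..t}"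
  using grid_mono[of t 0 i n] grid_mono[of t i "Suc n" n] by simp

text \<open>Index of the cell containing \<open>s\<close>. Cells are open on the left and closed on
  the right, as in \<open>{a<..b}\<close>, hence a ceiling minus 1 instead of a floor.\<close>

definition grid_index :: "real \<Rightarrow> nat \<Rightarrow> real \<Rightarrow> nat" where
  "grid_index t n s = nat (\<lceil>s * real (Suc n) / t\<rceil> - 1)"

lemma grid_index:
  assumes "0 < s" "s \<le> t"
  shows "grid_index t n s < Suc n"
    and "grid t n (grid_index t n s) < s" and "s \<le> grid t n (Suc (grid_index t n s))"
proof -
  define x where "x = s * real (Suc n) / t"
  have x: "0 < x" "x \<le> real (Suc n)" "s = t * x / real (Suc n)"
    using assms by (auto simp: x_def field_simps simp del: of_nat_Suc)
  define i where "i = nat (\<lceil>x\<rceil> - 1)"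
  have i: "real i < x" "x \<le> real (Suc i)"
    using x(1) unfolding i_def by linarith+
  show "grid_index t n s < Suc n"
    using i x(2) unfolding grid_index_def x_def[symmetric] i_def[symmetric] by linarith
  show "grid t n (grid_index t n s) < s" "s \<le> grid t n (Suc (grid_index t n s))"
    unfolding grid_index_def x_def[symmetric] i_def[symmetric] grid_def
    by (subst x(3), use i assms in \<open>intro divide_strict_right_mono divide_right_mono mult_strict_left_mono mult_left_mono; simp\<close>)+
qed

lemma grid_index_unique:
  assumes "0 < t" "grid t n i < s" "s \<le> grid t n (Suc i)" "grid t n j < s" "s \<le> grid t n (Suc j)"
  shows "i = j"
proof -
  have "\<not> Suc i \<le> j" "\<not> Suc j \<le> i"
    using assms grid_mono[of t "Suc i" j n] grid_mono[of t "Suc j" i n] by auto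
  then show ?thesis by simp
qed

text \<open>The left end of the cell lies strictly below \<open>s\<close> and within
  \<open>t / (n + 1)\<close> of it, so the approach is from the left, as left continuity
  requires.\<close>

lemma tendsto_grid_index:
  assumes "0 < s" "s \<le> t"
  shows "filterlim (\<lambda>n. grid t n (grid_index t n s)) (at_left s) sequentially"
proof -
  have lim: "(\<lambda>n. s - t * inverse (real (Suc n))) \<longlonglongrightarrow> s"
    using tendsto_diff[OF tendsto_const tendsto_mult_left[OF LIMSEQ_inverse_real_of_nat]] by fastforce
  have le: "s - t * inverse (real (Suc n)) \<le> grid t n (grid_index t n s)" for n
  proof -
    have "grid t n (Suc i) = grid t n i + t * inverse (real (Suc n))" for i
      by (simp add: grid_def divide_inverse distrib_left distrib_right)
    from this[of "grid_index t n s"] show ?thesis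
      using grid_index(3)[OF assms, of n] by linarith
  qed
  have "(\<lambda>n. grid t n (grid_index t n s)) \<longlonglongrightarrow> s"
    by (rule tendsto_sandwich[OF _ _ lim tendsto_const])
      (intro always_eventually allI le less_imp_le[OF grid_index(2)[OF assms]])+
  then show ?thesis
    by (rule filterlim_at_left_sequentiallyI[OF _ grid_index(2)[OF assms]])
qed

text \<open>The sums are integrals of step functions taking at \<open>s\<close> the value of
  \<open>f\<close> at the left end of the cell of \<open>s\<close>. Left continuity gives pointwise
  convergence, and boundedness on a set of finite measure gives domination. Vector values allow the
  same lemma to serve the scalar Stieltjes measures and the matrix-valued drift.\<close>

lemma left_continuous_riemann:
  fixes f :: "real \<Rightarrow> 'b :: {banach, second_countable_topology}"
  assumes sets: "sets \<mu> = sets borel" and fin: "emeasure \<mu> {0<..t} < \<infinity>" and t: "0 < t"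
    and cont: "\<And>s. 0 < s \<Longrightarrow> s \<le> t \<Longrightarrow> (f \<longlongrightarrow> f s) (at_left s)"
    and bd: "bounded (f ` {0..t})"
  shows "(\<lambda>n. \<Sum>i<Suc n. measure \<mu> {grid t n i<..grid t n (Suc i)} *\<^sub>R f (grid t n i))
           \<longlonglongrightarrow> (LINT s:{0<..t}|\<mu>. f s)"
proof -
  note [measurable_cong] = sets
  obtain K where "\<forall>x\<in>f ` {0..t}. norm x \<le> K"
    using bd unfolding bounded_iff by (rule exE)
  then have K: "\<And>s. s \<in> {0..t} \<Longrightarrow> norm (f s) \<le> K"
    by simp
  define \<phi> where "\<phi> n s = (\<Sum>i<Suc n. indicat_real {grid t n i<..grid t n (Suc i)} s *\<^sub>R f (grid t n i))" for n s
  have \<phi>_in: "\<phi> n s = f (grid t n (grid_index t n s))" if s: "0 < s" "s \<le> t" for n s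
  proof -
    have "indicat_real {grid t n i<..grid t n (Suc i)} s *\<^sub>R f (grid t n i)
        = (if i = grid_index t n s then f (grid t n i) else 0)" for i
    proof (cases "i = grid_index t n s")
      case True
      then have "s \<in> {grid t n i<..grid t n (Suc i)}"
        using grid_index(2,3)[OF s, of n] by simp
      with True show ?thesis by simp
    next
      case False
      then have "s \<notin> {grid t n i<..grid t n (Suc i)}"
        using grid_index_unique[OF t _ _ grid_index(2,3)[OF s], of n i] by auto
      with False show ?thesis by simp
    qed
    then show ?thesis
      using grid_index(1)[OF s, of n] by (simp add: \<phi>_def del: sum.lessThan_Suc)
  qed
  have sub: "{grid t n i<..grid t n (Suc i)} \<subseteq> {0<..t}" if "i < Suc n" for i n
    using grid_bounds[of t i n] grid_bounds[of t "Suc i" n] t that by auto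
  have \<phi>_out: "\<phi> n s = 0" if "s \<notin> {0<..t}" for n s
    unfolding \<phi>_def
  proof (intro sum.neutral ballI)
    fix i assume "i \<in> {..<Suc n}"
    then have "s \<notin> {grid t n i<..grid t n (Suc i)}" using sub[of i n] that by auto
    then show "indicat_real {grid t n i<..grid t n (Suc i)} s *\<^sub>R f (grid t n i) = 0" by simp
  qed
  have lim: "(\<lambda>n. \<phi> n s) \<longlonglongrightarrow> indicat_real {0<..t} s *\<^sub>R f s" for s
  proof (cases "s \<in> {0<..t}")
    case True
    then have "(\<lambda>n. f (grid t n (grid_index t n s))) \<longlonglongrightarrow> f s"
      using filterlim_compose[OF cont tendsto_grid_index] by auto
    then show ?thesis using True by (simp add: \<phi>_in)
  qed (simp add: \<phi>_out)
  have meas [measurable]: "\<phi> n \<in> borel_measurable \<mu>" for n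
    unfolding \<phi>_def by measurable
  have int_ind: "integrable \<mu> (indicat_real {grid t n i<..grid t n (Suc i)})" if "i < Suc n" for i n
    using fin emeasure_mono[OF sub[OF that], of \<mu>] sets
    by (intro integrable_real_indicator) auto
  have "(\<lambda>n. integral\<^sup>L \<mu> (\<phi> n)) \<longlonglongrightarrow> (LINT s|\<mu>. indicat_real {0<..t} s *\<^sub>R f s)"
  proof (rule integral_dominated_convergence[where w = "\<lambda>s. indicat_real {0<..t} s * K"])
    \<comment> \<open>Measurability of \<open>f\<close> on \<open>{0<..t}\<close> is not assumed; it
      is inherited from the step functions.\<close>
    show "(\<lambda>s. indicat_real {0<..t} s *\<^sub>R f s) \<in> borel_measurable \<mu>"
      by (rule borel_measurable_LIMSEQ_metric[OF meas lim])
    show "integrable \<mu> (\<lambda>s. indicat_real {0<..t} s * K)"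
      using fin sets by (intro integrable_mult_left integrable_real_indicator) auto
    show "AE s in \<mu>. norm (\<phi> n s) \<le> indicat_real {0<..t} s * K" for n
    proof (rule AE_I2)
      fix s
      show "norm (\<phi> n s) \<le> indicat_real {0<..t} s * K"
        using \<phi>_out[of s n] K[OF grid_bounds[of t "grid_index t n s" n]] grid_index(1)[of s t n] t
        by (cases "s \<in> {0<..t}") (auto simp: \<phi>_in)
    qed
  qed (use lim in auto)
  moreover have "integral\<^sup>L \<mu> (\<phi> n)
      = (\<Sum>i<Suc n. measure \<mu> {grid t n i<..grid t n (Suc i)} *\<^sub>R f (grid t n i))" for n
  proof -
    have "integral\<^sup>L \<mu> (\<phi> n) = (\<Sum>i<Suc n. LINT s|\<mu>. indicat_real {grid t n i<..grid t n (Suc i)} s *\<^sub>R f (grid t n i))"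
      unfolding \<phi>_def by (intro Bochner_Integration.integral_sum integrable_scaleR_left int_ind) auto
    also have "\<dots> = (\<Sum>i<Suc n. measure \<mu> {grid t n i<..grid t n (Suc i)} *\<^sub>R f (grid t n i))"
    proof (rule sum.cong)
      fix i assume "i \<in> {..<Suc n}"
      then show "(LINT s|\<mu>. indicat_real {grid t n i<..grid t n (Suc i)} s *\<^sub>R f (grid t n i)) =
         measure \<mu> {grid t n i<..grid t n (Suc i)} *\<^sub>R f (grid t n i)"
        using int_ind[of i n] sets_eq_imp_space_eq[OF sets]
        by (subst integral_scaleR_left) auto
    qed simp
    finally show ?thesis .
  qed
  ultimately show ?thesis
    by (simp add: set_lebesgue_integral_def del: sum.lessThan_Suc)
qed

text \<open>Both monotone parts converge separately, and their sums recombine into increments of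
  \<open>g\<close>. Afterwards the decomposition no longer appears, and the integral can be
  estimated through \<open>g\<close> alone.\<close>

lemma has_stieltjes_integral_riemann:
  assumes "has_stieltjes_integral f g 0 t I" and t: "0 < t"
    and cont: "\<And>s. 0 < s \<Longrightarrow> s \<le> t \<Longrightarrow> (f \<longlongrightarrow> f s) (at_left s)"
    and bd: "bounded (f ` {0..t})"
  shows "(\<lambda>n. \<Sum>i<Suc n. (g (grid t n (Suc i)) - g (grid t n i)) * f (grid t n i)) \<longlonglongrightarrow> I"
proof -
  obtain p q where pq: "mono p" "mono q" "\<And>x. continuous (at_right x) p" "\<And>x. continuous (at_right x) q"
      "\<And>x. x \<in> {0..t} \<Longrightarrow> g x = p x - q x"
      "I = (LINT x:{0<..t}|interval_measure p. f x) - (LINT x:{0<..t}|interval_measure q. f x)"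
    using assms(1) unfolding has_stieltjes_integral_def by blast
  have lim: "(\<lambda>n. \<Sum>i<Suc n. (h (grid t n (Suc i)) - h (grid t n i)) * f (grid t n i))
          \<longlonglongrightarrow> (LINT x:{0<..t}|interval_measure h. f x)"
    if h: "mono h" "\<And>x. continuous (at_right x) h" for h
  proof -
    have em: "emeasure (interval_measure h) {a<..b} = ennreal (h b - h a)" if "a \<le> b" for a b
      using h that by (intro emeasure_interval_measure_Ioc) (auto simp: mono_def)
    have "measure (interval_measure h) {grid t n i<..grid t n (Suc i)} = h (grid t n (Suc i)) - h (grid t n i)" for n i
      using em[OF grid_mono[of t i "Suc i" n]] h(1) t grid_mono[of t i "Suc i" n]
      by (simp add: measure_def monoD)
    then show ?thesis
      using left_continuous_riemann[of "interval_measure h" t f] em[of 0 t] t cont bd by simp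
  qed
  have "(\<lambda>n. (\<Sum>i<Suc n. (p (grid t n (Suc i)) - p (grid t n i)) * f (grid t n i))
      - (\<Sum>i<Suc n. (q (grid t n (Suc i)) - q (grid t n i)) * f (grid t n i))) \<longlonglongrightarrow> I"
    unfolding pq(6) by (intro tendsto_diff lim pq)
  moreover have "(\<Sum>i<Suc n. (p (grid t n (Suc i)) - p (grid t n i)) * f (grid t n i))
      - (\<Sum>i<Suc n. (q (grid t n (Suc i)) - q (grid t n i)) * f (grid t n i))
      = (\<Sum>i<Suc n. (g (grid t n (Suc i)) - g (grid t n i)) * f (grid t n i))" for n
  proof -
    \<comment> \<open>The decomposition represents \<open>g\<close> only on \<open>{0..t}\<close>,
      so the grid points must be known to lie there.\<close>
    have "g (grid t n i) = p (grid t n i) - q (grid t n i)" if "i \<le> Suc n" for i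
      using t that by (intro pq(5) grid_bounds) auto
    then show ?thesis
      unfolding sum_subtractf[symmetric] by (intro sum.cong refl) (simp add: left_diff_distrib)
  qed
  ultimately show ?thesis by (simp del: sum.lessThan_Suc)
qed

text \<open>At the first time \<open>\<tau>\<close> with \<open>u \<tau> \<le> y \<tau>\<close>, left limits of \<open>y\<close> up to \<open>\<tau>\<close> are at most \<open>u\<close>, so the
  Riemann sums telescope to at most \<open>u \<tau> - u 0\<close>, whence \<open>y \<tau> < u \<tau>\<close>.\<close>

lemma stieltjes_gronwall:
  fixes y yl W u :: "real \<Rightarrow> real"
  assumes right: "\<And>t. 0 \<le> t \<Longrightarrow> (y \<longlongrightarrow> y t) (at_right t)"
    and left: "\<And>t. 0 < t \<Longrightarrow> (y \<longlongrightarrow> yl t) (at_left t)" and yl0: "yl 0 = y 0"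
    and W: "\<And>s t. 0 \<le> s \<Longrightarrow> s \<le> t \<Longrightarrow> t \<le> N \<Longrightarrow> W s \<le> W t"
    and u: "\<And>s t. 0 \<le> s \<Longrightarrow> s \<le> t \<Longrightarrow> t \<le> N \<Longrightarrow> u s * (1 + (W t - W s)) \<le> u t"
    and u_nonneg: "\<And>s. 0 \<le> s \<Longrightarrow> s \<le> N \<Longrightarrow> 0 \<le> u s" and u0: "y 0 < u 0"
    and est: "\<And>t e. 0 < t \<Longrightarrow> t \<le> N \<Longrightarrow> 0 < e \<Longrightarrow> \<exists>n. y t \<le> y 0 +
      (\<Sum>i<Suc n. yl (grid t n i) * (W (grid t n (Suc i)) - W (grid t n i))) + e"
    and t: "0 \<le> t" "t \<le> N"
  shows "y t < u t"
proof (rule ccontr)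
  assume "\<not> y t < u t"
  define T where "T = {s. 0 \<le> s \<and> s \<le> N \<and> u s \<le> y s}"
  define \<tau> where "\<tau> = Inf T"
  have tT: "t \<in> T" using \<open>\<not> y t < u t\<close> t by (simp add: T_def)
  have bdd: "bdd_below T" by (auto simp: T_def intro!: bdd_belowI[of _ 0])
  have \<tau>: "0 \<le> \<tau>" "\<tau> \<le> N"
    using tT t bdd unfolding \<tau>_def
    by (auto simp: T_def intro!: cInf_greatest intro: cInf_lower2)
  have u_mono: "u r \<le> u s" if "0 \<le> r" "r \<le> s" "s \<le> N" for r s
  proof -
    have "u r * 1 \<le> u r * (1 + (W s - W r))"
      using W[OF that] u_nonneg[of r] that by (intro mult_left_mono) auto
    then show ?thesis using u[OF that] by simp
  qed
  have below: "y s < u s" if "0 \<le> s" "s < \<tau>" for s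
    using that \<tau>(2) cInf_lower[OF _ bdd, of s] by (force simp: T_def \<tau>_def)
  have yl_le: "yl s \<le> u s" if s: "0 \<le> s" "s \<le> \<tau>" for s
  proof (cases "s = 0")
    case False
    have "\<forall>\<^sub>F r in at_left s. y r \<le> u s"
    proof -
      have "y r \<le> u s" if "0 < r" "r < s" for r
        using below[of r] u_mono[of r s] that s \<tau> by simp
      then show ?thesis
        using s False by (auto simp: eventually_at_left[of 0 s] intro!: exI[of _ 0])
    qed
    then show ?thesis
      using s False by (intro tendsto_upperbound[OF left]) auto
  qed (use yl0 u0 in simp)
  have y\<tau>: "y \<tau> < u \<tau>"
  proof (cases "\<tau> = 0")
    case False
    then have pos: "0 < \<tau>" using \<tau> by simp
    \<comment> \<open>Half of the initial gap between \<open>u\<close> and \<open>y\<close> pays for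
      the Riemann error.\<close>
    obtain n where n: "y \<tau> \<le> y 0 +
      (\<Sum>i<Suc n. yl (grid \<tau> n i) * (W (grid \<tau> n (Suc i)) - W (grid \<tau> n i))) + (u 0 - y 0) / 2"
      using est[OF pos \<tau>(2), of "(u 0 - y 0) / 2"] u0 by auto
    have "(\<Sum>i<Suc n. yl (grid \<tau> n i) * (W (grid \<tau> n (Suc i)) - W (grid \<tau> n i)))
        \<le> (\<Sum>i<Suc n. u (grid \<tau> n (Suc i)) - u (grid \<tau> n i))"
    proof (rule sum_mono)
      fix i assume "i \<in> {..<Suc n}"
      then have g: "grid \<tau> n i \<in> {0..\<tau>}" "grid \<tau> n (Suc i) \<in> {0..\<tau>}"
        using \<tau>(1) by (auto intro!: grid_bounds simp del: atLeastAtMost_iff)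
      have le: "grid \<tau> n i \<le> grid \<tau> n (Suc i)" using \<tau>(1) by (simp add: grid_mono)
      have "yl (grid \<tau> n i) * (W (grid \<tau> n (Suc i)) - W (grid \<tau> n i))
          \<le> u (grid \<tau> n i) * (W (grid \<tau> n (Suc i)) - W (grid \<tau> n i))"
        using g le \<tau>(2) W[of "grid \<tau> n i" "grid \<tau> n (Suc i)"] by (intro mult_right_mono yl_le) auto
      also have "\<dots> \<le> u (grid \<tau> n (Suc i)) - u (grid \<tau> n i)"
        using g le \<tau>(2) u[of "grid \<tau> n i" "grid \<tau> n (Suc i)"] by (simp add: algebra_simps)
      finally show "yl (grid \<tau> n i) * (W (grid \<tau> n (Suc i)) - W (grid \<tau> n i))
        \<le> u (grid \<tau> n (Suc i)) - u (grid \<tau> n i)" .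
    qed
    also have "\<dots> = u \<tau> - u 0"
      by (subst sum_lessThan_telescope) simp
    finally have "y \<tau> \<le> y 0 + (u \<tau> - u 0) + (u 0 - y 0) / 2"
      by (intro order_trans[OF n] add_right_mono add_left_mono)
    then show ?thesis using u0 by (simp add: field_simps)
  qed (use u0 in simp)
  \<comment> \<open>Right continuity keeps \<open>y\<close> below \<open>u \<tau>\<close> for a
    while after \<open>\<tau>\<close>, and \<open>u\<close> is nondecreasing; so no point of
    \<open>T\<close> is near its infimum. Continuity of \<open>u\<close> is not involved.\<close>
  then have "\<forall>\<^sub>F s in at_right \<tau>. y s < u \<tau>"
    using right[OF \<tau>(1)] by (rule order_tendstoD(2)[rotated])
  then obtain b where b: "b > \<tau>" "\<And>s. \<tau> < s \<Longrightarrow> s < b \<Longrightarrow> y s < u \<tau>"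
    using eventually_at_right[of \<tau> "\<tau> + 1"] by auto
  have "b \<le> s" if "s \<in> T" for s
  proof (rule ccontr)
    assume "\<not> b \<le> s"
    have "\<tau> \<le> s" unfolding \<tau>_def by (rule cInf_lower[OF that bdd])
    then have "y s < u s"
      using \<open>\<not> b \<le> s\<close> b(2)[of s] y\<tau> u_mono[of \<tau> s] \<tau>(1) that
      by (cases "s = \<tau>") (auto simp: T_def)
    then show False using that by (simp add: T_def)
  qed
  then have "b \<le> \<tau>" unfolding \<tau>_def using tT by (intro cInf_greatest) auto
  then show False using b(1) by simp
qed

section \<open>Pathwise bound\<close>

lemma one_plus_sum_le_prod:
  fixes f :: "'b \<Rightarrow> real"
  assumes "\<And>i. i \<in> S \<Longrightarrow> 0 \<le> f i"
  shows "1 + sum f S \<le> (\<Prod>i\<in>S. 1 + f i)"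
  using assms
proof (induction S rule: infinite_finite_induct)
  case (insert x S)
  have "(1 + f x) * (1 + sum f S) \<le> (1 + f x) * (\<Prod>i\<in>S. 1 + f i)"
    using insert by (intro mult_left_mono) auto
  moreover have "0 \<le> f x * sum f S"
    using insert by (intro mult_nonneg_nonneg sum_nonneg) auto
  ultimately show ?case
    using insert by (simp add: algebra_simps)
qed auto

text \<open>The infinite product over the jump times in \<open>{0<..t}\<close>. For factors that are
  at least 1 and have bounded finite products, the supremum gives it without prior knowledge that
  the jumps are summable.\<close>

definition jump_prod :: "real \<Rightarrow> (real \<Rightarrow> real) \<Rightarrow> real \<Rightarrow> real" where
  "jump_prod a v t = (SUP S\<in>{S. finite S \<and> S \<subseteq> {0<..t}}. \<Prod>s\<in>S. 1 + a * v s)"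

text \<open>Here \<open>v s\<close> stands for the squared norm of the jump at \<open>s\<close> and
  \<open>Q\<close> for a bound available on the path considered. With \<open>v 0 = 0\<close>, sums
  over \<open>{0..t}\<close> and products over \<open>{0<..t}\<close> see the same jumps.\<close>

locale bounded_jump_products =
  fixes a :: real and v :: "real \<Rightarrow> real" and N Q :: real
  assumes a: "0 < a" and v: "\<And>s. 0 \<le> v s" and v0: "v 0 = 0"
    and Q: "\<And>S. finite S \<Longrightarrow> S \<subseteq> {0<..N} \<Longrightarrow> (\<Prod>s\<in>S. 1 + a * v s) \<le> Q"
begin

lemma prod_pos: "0 < (\<Prod>s\<in>S. 1 + a * v s)"
  using a v by (intro Groups_Big.prod_pos) (simp add: add_pos_nonneg)

lemma prod_le_jump_prod:
  assumes "t \<le> N" "finite S" "S \<subseteq> {0<..t}"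
  shows "(\<Prod>s\<in>S. 1 + a * v s) \<le> jump_prod a v t"
  unfolding jump_prod_def
proof (rule cSUP_upper)
  show "bdd_above ((\<lambda>S. \<Prod>s\<in>S. 1 + a * v s) ` {S. finite S \<and> S \<subseteq> {0<..t}})"
    using assms(1) by (intro bdd_aboveI[of _ Q]) (auto intro!: Q)
qed (use assms in auto)

lemma jump_prod_le: "t \<le> N \<Longrightarrow> jump_prod a v t \<le> Q"
  unfolding jump_prod_def by (intro cSUP_least) (auto intro!: Q)

lemma jump_prod_ge_1: "t \<le> N \<Longrightarrow> 1 \<le> jump_prod a v t"
  using prod_le_jump_prod[of t "{}"] by simp

lemma jump_prod_0: "jump_prod a v 0 = 1"
proof -
  have "{S :: real set. finite S \<and> S \<subseteq> {0<..0}} = {{}}" by auto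
  then show ?thesis by (simp add: jump_prod_def)
qed

text \<open>A product dominates 1 plus the sum of its increments, so the bound \<open>Q\<close> on
  finite products bounds all finite sums. This is what gives the infinite sum in
  \<open>jump_quad_var\<close> its intended meaning.\<close>

lemma summable: "v summable_on {0..N}"
proof (rule nonneg_bdd_above_summable_on)
  show "bdd_above (sum v ` {F. F \<subseteq> {0..N} \<and> finite F})"
  proof (rule bdd_aboveI)
    fix x assume "x \<in> sum v ` {F. F \<subseteq> {0..N} \<and> finite F}"
    then obtain F where F: "x = sum v F" "F \<subseteq> {0..N}" "finite F" by auto
    have "a * x = sum (\<lambda>s. a * v s) (F - {0})"
      using F v0 by (simp add: sum_distrib_left sum_diff1)
    also have "\<dots> \<le> (\<Prod>s\<in>F - {0}. 1 + a * v s)"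
      using one_plus_sum_le_prod[of "F - {0}" "\<lambda>s. a * v s"] a v by simp
    also have "\<dots> \<le> Q"
      using F by (intro Q) force+
    finally show "x \<le> Q / a" using a by (simp add: field_simps)
  qed
qed (use v in auto)

lemma summable_subset: "S \<subseteq> {0..N} \<Longrightarrow> v summable_on S"
  by (rule summable_on_subset_banach[OF summable])

text \<open>Finite sets of times in \<open>{0<..s}\<close> and in \<open>{s<..t}\<close> are
  disjoint, so their products multiply to one counted in \<open>jump_prod a v t\<close>, and the
  later product dominates 1 plus its sum.\<close>

lemma jump_prod_increment:
  assumes "0 \<le> s" "s \<le> t" "t \<le> N"
  shows "jump_prod a v s * (1 + a * infsum v {s<..t}) \<le> jump_prod a v t"
proof -
  define w where "w = infsum v {s<..t}"
  have w: "w \<ge> 0" unfolding w_def by (intro infsum_nonneg) (use v in auto)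
  have "(\<Prod>s\<in>S. 1 + a * v s) \<le> jump_prod a v t / (1 + a * w)" if S: "finite S" "S \<subseteq> {0<..s}" for S
  proof -
    let ?p = "\<Prod>s\<in>S. 1 + a * v s"
    \<comment> \<open>The inequality is solved for the sum because a bound on all finite partial
      sums passes to \<open>infsum\<close>.\<close>
    have "w \<le> (jump_prod a v t / ?p - 1) / a"
      unfolding w_def
    proof (rule infsum_le_finite_sums)
      show "v summable_on {s<..t}"
        using assms by (intro summable_subset) auto
      fix F assume F: "finite F" "F \<subseteq> {s<..t}"
      have "?p * (1 + (\<Sum>s\<in>F. a * v s)) \<le> ?p * (\<Prod>s\<in>F. 1 + a * v s)"
        using a v prod_pos[of S] by (intro mult_left_mono one_plus_sum_le_prod) auto
      also have "\<dots> = (\<Prod>s\<in>S \<union> F. 1 + a * v s)"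
        using S F by (intro prod.union_disjoint[symmetric]) fastforce+
      also have "\<dots> \<le> jump_prod a v t"
        using S F assms by (intro prod_le_jump_prod) auto
      finally show "sum v F \<le> (jump_prod a v t / ?p - 1) / a"
        using a prod_pos[of S] by (simp add: field_simps flip: sum_distrib_left)
    qed
    moreover have "1 + a * w > 0" using a w by (simp add: add_pos_nonneg)
    ultimately show ?thesis
      using a prod_pos[of S] by (simp add: field_simps)
  qed
  then have "jump_prod a v s \<le> jump_prod a v t / (1 + a * w)"
    unfolding jump_prod_def[of a v s] by (intro cSUP_least) auto
  moreover have "1 + a * w > 0" using a w by (simp add: add_pos_nonneg)
  ultimately show ?thesis by (simp add: w_def field_simps)
qed

end

lemma norm_outer_product: "norm (\<chi> i j. x $ i * x $ j) = (norm (x :: real ^ 'n))\<^sup>2"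
proof -
  have "(\<chi> i j. x $ i * x $ j) = (\<chi> i. x $ i *\<^sub>R x)"
    by (simp add: vec_eq_iff)
  then have "norm (\<chi> i j. x $ i * x $ j) = L2_set (\<lambda>i. norm (x $ i) * norm x) UNIV"
    by (simp add: norm_vec_def[of "\<chi> i. x $ i *\<^sub>R x"])
  also have "\<dots> = norm x * norm x"
    by (simp add: norm_vec_def[of x] L2_set_left_distrib)
  finally show ?thesis by (simp add: power2_eq_square)
qed

lemma infsum_interval_diff:
  fixes f :: "real \<Rightarrow> 'b :: banach"
  assumes "f summable_on {0..N}" "0 \<le> s" "s \<le> t" "t \<le> N"
  shows "infsum f {0..t} - infsum f {0..s} = infsum f {s<..t}"
proof -
  have "infsum f ({0..s} \<union> {s<..t}) = infsum f {0..s} + infsum f {s<..t}"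
    using assms by (intro infsum_Un_disjoint summable_on_subset_banach[OF assms(1)]) auto
  moreover have "{0..s} \<union> {s<..t} = {0..t}" using assms by auto
  ultimately show ?thesis by simp
qed

lemma norm_jump_quad_var_diff:
  assumes "bounded_jump_products a (\<lambda>s. (norm (jump l s))\<^sup>2) N Q" "0 \<le> s" "s \<le> t" "t \<le> N"
  shows "norm (jump_quad_var l t - jump_quad_var l s) \<le> infsum (\<lambda>s. (norm (jump l s))\<^sup>2) {s<..t}"
proof -
  interpret bounded_jump_products a "\<lambda>s. (norm (jump l s))\<^sup>2" N Q by fact
  let ?X = "\<lambda>s. \<chi> i j. jump l s $ i * jump l s $ j"
  have abs: "(\<lambda>s. norm (?X s)) summable_on S" if "S \<subseteq> {0..N}" for S
    using summable_subset[OF that] by (simp add: norm_outer_product)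
  have "norm (jump_quad_var l t - jump_quad_var l s) = norm (infsum ?X {s<..t})"
    unfolding jump_quad_var_def using assms(2-)
    by (subst infsum_interval_diff[of _ N]) (auto intro: abs_summable_summable abs)
  also have "\<dots> \<le> (\<Sum>\<^sub>\<infinity>s\<in>{s<..t}. norm (?X s))"
    using assms(2-) by (intro norm_infsum_bound abs) auto
  finally show ?thesis by (simp add: norm_outer_product)
qed

section \<open>Jumps as limits of dyadic increments\<close>

lemma dyadic_tendsto:
  fixes s :: real
  assumes "0 < s"
  defines "k \<equiv> \<lambda>n. nat (\<lceil>s * 2 ^ n\<rceil> - 1)"
  shows "real (k n) / 2 ^ n < s" "s \<le> real (Suc (k n)) / 2 ^ n"
    and "filterlim (\<lambda>n. real (k n) / 2 ^ n) (at_left s) sequentially"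
    and "(\<lambda>n. real (Suc (k n)) / 2 ^ n) \<longlonglongrightarrow> s"
proof -
  have k: "real (k n) < s * 2 ^ n" "s * 2 ^ n \<le> real (Suc (k n))" for n
  proof -
    have "0 < s * 2 ^ n" using assms(1) by simp
    then show "real (k n) < s * 2 ^ n" "s * 2 ^ n \<le> real (Suc (k n))"
      unfolding k_def by linarith+
  qed
  show bounds: "real (k n) / 2 ^ n < s" "s \<le> real (Suc (k n)) / 2 ^ n" for n
    using k[of n] by (auto simp: field_simps)
  have h: "(\<lambda>n. (1 / 2) ^ n :: real) \<longlonglongrightarrow> 0"
    by (rule LIMSEQ_power_zero) simp
  have eq: "real (Suc (k n)) / 2 ^ n = real (k n) / 2 ^ n + (1 / 2) ^ n" for n
    by (simp add: add_divide_distrib power_divide)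
  have "(\<lambda>n. real (k n) / 2 ^ n) \<longlonglongrightarrow> s"
  proof (rule tendsto_sandwich[of "\<lambda>n. s - (1/2) ^ n" _ _ "\<lambda>_. s"])
    show "(\<lambda>n. s - (1 / 2) ^ n) \<longlonglongrightarrow> s"
      using tendsto_diff[OF tendsto_const[of s] h] by simp
    show "\<forall>\<^sub>F n in sequentially. s - (1 / 2) ^ n \<le> real (k n) / 2 ^ n"
      using bounds(2) eq by (auto simp: diff_le_eq)
  qed (use less_imp_le[OF bounds(1)] in auto)
  then show "filterlim (\<lambda>n. real (k n) / 2 ^ n) (at_left s) sequentially"
    by (rule filterlim_at_left_sequentiallyI[OF _ bounds(1)])
  show "(\<lambda>n. real (Suc (k n)) / 2 ^ n) \<longlonglongrightarrow> s"
    unfolding eq using tendsto_add[OF \<open>(\<lambda>n. real (k n) / 2 ^ n) \<longlonglongrightarrow> s\<close> h] by simp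
qed

text \<open>At each \<open>s\<close> in \<open>S\<close> the increment over the dyadic cell
  containing \<open>s\<close> converges to the jump. Once the mesh is below all distances within
  \<open>S\<close>, the cells are distinct, and the other factors of the grid product are at least
  1. The weight \<open>b\<close> and exponent \<open>p\<close> later carry the initial value and the
  order of the moment.\<close>

lemma jump_product_le_liminf:
  fixes l :: "real \<Rightarrow> 'b :: real_normed_vector" and N :: nat
  assumes l: "cadlag l" and S: "finite S" "S \<subseteq> {0<..real N}" and a: "0 \<le> a" and b: "0 \<le> b"
  shows "ennreal (b * (\<Prod>s\<in>S. 1 + a * (norm (jump l s))\<^sup>2) ^ p) \<le> liminf (\<lambda>n. ennreal
    (b * (\<Prod>i<N * 2 ^ n. 1 + a * (norm (l (real (Suc i) / 2 ^ n) - l (real i / 2 ^ n)))\<^sup>2) ^ p))"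
proof -
  define k where "k s n = nat (\<lceil>s * 2 ^ n\<rceil> - 1)" for s :: real and n
  define f where "f n i = 1 + a * (norm (l (real (Suc i) / 2 ^ n) - l (real i / 2 ^ n)))\<^sup>2" for n i
  have f: "1 \<le> f n i" for n i using a by (simp add: f_def)
  have pos: "0 < s" if "s \<in> S" for s using S(2) that by auto
  note k = dyadic_tendsto[OF pos, folded k_def]
  have lim: "(\<lambda>n. f n (k s n)) \<longlonglongrightarrow> 1 + a * (norm (jump l s))\<^sup>2" if s: "s \<in> S" for s
  proof -
    \<comment> \<open>The right end of the cell may equal \<open>s\<close>, so convergence within
      \<open>{s..}\<close> is needed and not merely along \<open>at_right s\<close>.\<close>
    have "continuous (at s within {s..}) l"
      using l pos[OF s] by (simp add: cadlag_def continuous_within at_within_Ici_at_right)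
    then have "(\<lambda>n. l (real (Suc (k s n)) / 2 ^ n)) \<longlonglongrightarrow> l s"
      using k(2,4)[OF s] by (intro continuous_within_tendsto_compose'[of s "{s..}" l]) auto
    moreover have "(\<lambda>n. l (real (k s n) / 2 ^ n)) \<longlonglongrightarrow> left_limit l s"
      by (rule filterlim_compose[OF tendsto_left_limit[OF l pos[OF s]] k(3)[OF s]])
    ultimately show ?thesis
      unfolding f_def jump_def by (intro tendsto_intros)
  qed
  have "\<forall>\<^sub>F n in sequentially. k s n \<noteq> k r n" if "s \<in> S" "r \<in> S" "s \<noteq> r" for s r
  proof -
    have "(\<lambda>n. (1 / 2) ^ n :: real) \<longlonglongrightarrow> 0"
      by (rule LIMSEQ_power_zero) simp
    then have "\<forall>\<^sub>F n in sequentially. (1 / 2) ^ n < \<bar>s - r\<bar>"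
      using that(3) by (intro order_tendstoD(2)) auto
    then show ?thesis
    proof eventually_elim
      case (elim n)
      have "s - r < (1 / 2) ^ n" "r - s < (1 / 2) ^ n" if "k s n = k r n"
        using k(1,2)[OF \<open>s \<in> S\<close>, of n] k(1,2)[OF \<open>r \<in> S\<close>, of n] that
        by (auto simp: add_divide_distrib power_divide)
      then show ?case using elim by force
    qed
  qed
  then have "\<forall>\<^sub>F n in sequentially. \<forall>s\<in>S. \<forall>r\<in>S. s \<noteq> r \<longrightarrow> k s n \<noteq> k r n"
    by (intro eventually_ball_finite ballI S(1)) auto
  then have "\<forall>\<^sub>F n in sequentially. (\<Prod>s\<in>S. f n (k s n)) \<le> (\<Prod>i<N * 2 ^ n. f n i)"
  proof eventually_elim
    case (elim n)
    have "k s n < N * 2 ^ n" if "s \<in> S" for s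
    proof -
      have "real (k s n) / 2 ^ n < real N"
        using k(1)[OF that, of n] S(2) that by force
      then have "real (k s n) < real (N * 2 ^ n)" by (simp add: field_simps)
      then show ?thesis by (simp only: of_nat_less_iff)
    qed
    then have "(\<Prod>i\<in>(\<lambda>s. k s n) ` S. f n i) \<le> (\<Prod>i<N * 2 ^ n. f n i)"
      using f by (intro prod_mono2) (auto intro: order_trans[of 0 1])
    moreover have "inj_on (\<lambda>s. k s n) S"
      using elim by (auto simp: inj_on_def)
    ultimately show ?case by (simp add: prod.reindex)
  qed
  then have "\<forall>\<^sub>F n in sequentially. ennreal (b * (\<Prod>s\<in>S. f n (k s n)) ^ p) \<le> ennreal (b * (\<Prod>i<N * 2 ^ n. f n i) ^ p)"
  proof eventually_elim
    case (elim n)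
    have "0 \<le> f n i" for i
      using f[of n i] by simp
    with elim show ?case
      by (intro ennreal_leI mult_left_mono power_mono b prod_nonneg) auto
  qed
  then have "liminf (\<lambda>n. ennreal (b * (\<Prod>s\<in>S. f n (k s n)) ^ p)) \<le> liminf (\<lambda>n. ennreal (b * (\<Prod>i<N * 2 ^ n. f n i) ^ p))"
    by (rule Liminf_mono)
  moreover have "(\<lambda>n. ennreal (b * (\<Prod>s\<in>S. f n (k s n)) ^ p))
      \<longlonglongrightarrow> ennreal (b * (\<Prod>s\<in>S. 1 + a * (norm (jump l s))\<^sup>2) ^ p)"
    by (intro tendsto_ennrealI tendsto_intros lim)
  ultimately show ?thesis
    by (simp add: lim_imp_Liminf f_def)
qed

section \<open>Matrix Riemann sums and the estimate along one path\<close>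

lemma matrix_triple_product_nth:
  fixes H D K :: "real ^ 'n ^ 'n"
  shows "((H ** D) ** K) $ i $ j = (\<Sum>k\<in>UNIV. \<Sum>l\<in>UNIV. D $ k $ l * (H $ i $ k * K $ l $ j))"
proof -
  have "((H ** D) ** K) $ i $ j = (\<Sum>l\<in>UNIV. \<Sum>k\<in>UNIV. D $ k $ l * (H $ i $ k * K $ l $ j))"
    by (simp add: matrix_matrix_mult_def sum_distrib_right sum_distrib_left mult_ac)
  also have "\<dots> = (\<Sum>k\<in>UNIV. \<Sum>l\<in>UNIV. D $ k $ l * (H $ i $ k * K $ l $ j))"
    by (rule sum.swap)
  finally show ?thesis .
qed

text \<open>The scalar limits are reassembled into products of matrices, so that norm estimates
  apply to each cell as a whole.\<close>

lemma has_matrix_stieltjes_integral_riemann: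
  fixes H K X :: "real \<Rightarrow> real ^ 'n ^ 'n"
  assumes "has_matrix_stieltjes_integral H X K 0 t J" and t: "0 < t"
    and H: "\<And>s. 0 < s \<Longrightarrow> s \<le> t \<Longrightarrow> (H \<longlongrightarrow> H s) (at_left s)" "bounded (H ` {0..t})"
    and K: "\<And>s. 0 < s \<Longrightarrow> s \<le> t \<Longrightarrow> (K \<longlongrightarrow> K s) (at_left s)" "bounded (K ` {0..t})"
  shows "(\<lambda>n. \<Sum>m<Suc n. (H (grid t n m) ** (X (grid t n (Suc m)) - X (grid t n m))) ** K (grid t n m))
           \<longlonglongrightarrow> J"
proof -
  obtain I where I: "\<And>i j k l. has_stieltjes_integral
                       (\<lambda>s. H s $ i $ k * K s $ l $ j) (\<lambda>s. X s $ k $ l) 0 t (I i j k l)"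
    and J: "J = (\<chi> i j. \<Sum>k\<in>UNIV. \<Sum>l\<in>UNIV. I i j k l)"
    using assms(1) unfolding has_matrix_stieltjes_integral_def by blast
  have entry: "\<bar>Z $ i $ j\<bar> \<le> norm Z" for Z :: "real ^ 'n ^ 'n" and i j
    using component_le_norm_cart[of "Z $ i" j] Finite_Cartesian_Product.norm_nth_le[of Z i] by simp
  obtain c where c: "\<forall>x\<in>H ` {0..t}. norm x \<le> c"
    using H(2) unfolding bounded_iff by (rule exE)
  obtain d where d: "\<forall>x\<in>K ` {0..t}. norm x \<le> d"
    using K(2) unfolding bounded_iff by (rule exE)
  have bd: "bounded ((\<lambda>s. H s $ i $ k * K s $ l $ j) ` {0..t})" for i j k l
    unfolding bounded_iff
  proof (intro exI[of _ "c * d"] ballI)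
    fix x assume "x \<in> (\<lambda>s. H s $ i $ k * K s $ l $ j) ` {0..t}"
    then obtain s where s: "x = H s $ i $ k * K s $ l $ j" "s \<in> {0..t}" by auto
    have "\<bar>H s $ i $ k\<bar> \<le> c" "\<bar>K s $ l $ j\<bar> \<le> d"
      using c d s(2) entry[of "H s" i k] entry[of "K s" l j] by (auto intro: order_trans)
    moreover from this have "0 \<le> c" by linarith
    ultimately show "norm x \<le> c * d"
      unfolding s(1) real_norm_def abs_mult by (intro mult_mono) auto
  qed
  have lim: "(\<lambda>n. \<Sum>m<Suc n. (X (grid t n (Suc m)) $ k $ l - X (grid t n m) $ k $ l) *
      (H (grid t n m) $ i $ k * K (grid t n m) $ l $ j)) \<longlonglongrightarrow> I i j k l" for i j k l
    by (rule has_stieltjes_integral_riemann[OF I t _ bd]) (intro tendsto_intros H K)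
  have "(\<lambda>n. (\<Sum>m<Suc n. (H (grid t n m) ** (X (grid t n (Suc m)) - X (grid t n m))) ** K (grid t n m)) $ i $ j)
     \<longlonglongrightarrow> J $ i $ j" for i j
  proof -
    have "(\<lambda>n. \<Sum>k\<in>UNIV. \<Sum>l\<in>UNIV. \<Sum>m<Suc n. (X (grid t n (Suc m)) $ k $ l - X (grid t n m) $ k $ l) *
      (H (grid t n m) $ i $ k * K (grid t n m) $ l $ j)) \<longlonglongrightarrow> (\<Sum>k\<in>UNIV. \<Sum>l\<in>UNIV. I i j k l)"
      by (intro tendsto_sum lim)
    moreover have "(\<Sum>m<Suc n. (H (grid t n m) ** (X (grid t n (Suc m)) - X (grid t n m))) ** K (grid t n m)) $ i $ j
      = (\<Sum>k\<in>UNIV. \<Sum>l\<in>UNIV. \<Sum>m<Suc n. (X (grid t n (Suc m)) $ k $ l - X (grid t n m) $ k $ l) *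
      (H (grid t n m) $ i $ k * K (grid t n m) $ l $ j))" (is "?L = ?R") for n
    proof -
      have "?L = (\<Sum>m<Suc n. \<Sum>k\<in>UNIV. \<Sum>l\<in>UNIV. (X (grid t n (Suc m)) $ k $ l - X (grid t n m) $ k $ l) *
          (H (grid t n m) $ i $ k * K (grid t n m) $ l $ j))"
        by (simp only: sum_component matrix_triple_product_nth vector_minus_component)
      also have "\<dots> = (\<Sum>k\<in>UNIV. \<Sum>m<Suc n. \<Sum>l\<in>UNIV. (X (grid t n (Suc m)) $ k $ l - X (grid t n m) $ k $ l) *
          (H (grid t n m) $ i $ k * K (grid t n m) $ l $ j))"
        by (rule sum.swap)
      also have "\<dots> = ?R"
        by (intro sum.cong refl sum.swap)
      finally show ?thesis .
    qed
    ultimately show ?thesis by (simp only: J vec_lambda_beta)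
  qed
  then show ?thesis
    by (intro vec_tendstoI)
qed

text \<open>Continuity of the root is available along sequences of positive definite matrices;
  sequences in the open interval from 0 to \<open>s\<close> provide them.\<close>

lemma tendsto_mat_sqrt_left_limit:
  fixes Y :: "real \<Rightarrow> real ^ 'n ^ 'n"
  assumes C: "pos_def C" and Y: "cadlag Y" "\<And>t. 0 \<le> t \<Longrightarrow> pos_semidef (Y t)" and s: "0 < s"
  shows "((\<lambda>r. mat_sqrt (C + left_limit Y r)) \<longlongrightarrow> mat_sqrt (C + left_limit Y s)) (at_left s)"
proof (rule tendsto_at_left_sequentially[of 0])
  fix S :: "nat \<Rightarrow> real"
  assume S: "\<And>n. S n < s" "\<And>n. 0 < S n" "S \<longlonglongrightarrow> s"
  have pd: "pos_def (C + left_limit Y r)" if "0 \<le> r" for r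
    using left_limit_in_closed[OF Y(1) closed_pos_semidef that] Y(2)
    by (intro pos_def_add_pos_semidef C) auto
  have "filterlim S (at_left s) sequentially"
    by (rule filterlim_at_left_sequentiallyI[OF S(3,1)])
  then have "(\<lambda>n. left_limit Y (S n)) \<longlonglongrightarrow> left_limit Y s"
    by (rule filterlim_compose[OF left_limit_left_continuous[OF Y(1) s]])
  then show "(\<lambda>n. mat_sqrt (C + left_limit Y (S n))) \<longlonglongrightarrow> mat_sqrt (C + left_limit Y s)"
    using S(2) s by (intro tendsto_mat_sqrt pd tendsto_intros less_imp_le)
qed (use s in simp)

text \<open>The content of \<open>mucogarch_volatility\<close> for a single trajectory, separated
  from adaptedness and null sets so that the comparison is deterministic.\<close>

definition mucogarch_path ::
  "real ^ 'n ^ 'n \<Rightarrow> real ^ 'n ^ 'n \<Rightarrow> real ^ 'n ^ 'n \<Rightarrow>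
     (real \<Rightarrow> real ^ 'n) \<Rightarrow> (real \<Rightarrow> real ^ 'n ^ 'n) \<Rightarrow> bool" where
  "mucogarch_path A B C l Y \<longleftrightarrow> cadlag Y \<and> (\<forall>t\<ge>0. pos_semidef (Y t)) \<and>
     (\<forall>t\<ge>0. has_matrix_stieltjes_integral
        (\<lambda>s. A ** mat_sqrt (C + left_limit Y s)) (jump_quad_var l)
        (\<lambda>s. mat_sqrt (C + left_limit Y s) ** transpose A) 0 t
        (Y t - Y 0 - (LINT s:{0..t}|lborel. B ** left_limit Y s + left_limit Y s ** transpose B)))"

text \<open>The constant \<open>a\<close> bounds the coefficients of the equation: the drift is at most \<open>a |Y\<^sub>-|\<close> and a
  jump of \<open>Y\<close> is at most \<open>a (|C| + |Y\<^sub>-|) |\<Delta>L|\<^sup>2\<close>.\<close>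

lemma mucogarch_pathwise_bound:
  fixes A B C :: "real ^ 'n ^ 'n"
  assumes C: "pos_def C"
  obtains a where "a > 0"
    "\<And>Y l N Q t. mucogarch_path A B C l Y \<Longrightarrow>
       (\<And>S. finite S \<Longrightarrow> S \<subseteq> {0<..N} \<Longrightarrow> (\<Prod>s\<in>S. 1 + a * (norm (jump l s))\<^sup>2) \<le> Q) \<Longrightarrow>
       0 \<le> t \<Longrightarrow> t \<le> N \<Longrightarrow> norm (Y t) \<le> (norm (Y 0) + norm C + 1) * exp (a * N) * Q"
proof -
  obtain K where K: "0 < K" "\<And>(X :: real ^ 'n ^ 'n) (Z :: real ^ 'n ^ 'n). norm (X ** Z) \<le> norm X * norm Z * K"
    using bounded_bilinear.pos_bounded[OF bounded_bilinear_matrix_mult] by blast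
  define b where "b = norm B * K + norm (transpose B) * K"
  \<comment> \<open>Four matrix multiplications give \<open>K ^ 4\<close>; the two square roots give
    the factor \<open>real CARD('n)\<close>.\<close>
  define j where "j = norm A * norm (transpose A) * K ^ 4 * real CARD('n)"
  \<comment> \<open>A single constant dominates drift and jump coefficients; the added 1 makes it
    positive even if both vanish.\<close>
  define a where "a = b + j + 1"
  have bj: "0 \<le> b" "0 \<le> j" using K(1) by (auto simp: b_def j_def)
  then have a: "a > 0" by (simp add: a_def)
  have drift: "norm (B ** Z + Z ** transpose B) \<le> b * norm Z" for Z :: "real ^ 'n ^ 'n"
    using norm_triangle_ineq[of "B ** Z" "Z ** transpose B"] K(2)[of B Z] K(2)[of Z "transpose B"]
    by (simp add: b_def algebra_simps)
  have jumps: "norm ((A ** mat_sqrt X ** D) ** (mat_sqrt X ** transpose A)) \<le> j * norm X * norm D"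
    if "pos_def X" for X D :: "real ^ 'n ^ 'n"
  proof -
    let ?R = "mat_sqrt X"
    have "norm ((A ** ?R ** D) ** (?R ** transpose A))
      \<le> norm A * norm ?R * K * norm D * K * (norm ?R * norm (transpose A) * K) * K"
      by (intro order_trans[OF K(2)] mult_right_mono mult_mono mult_nonneg_nonneg order_refl)
        (use K(1) in auto)
    also have "\<dots> = norm A * norm (transpose A) * K ^ 4 * norm D * (norm ?R)\<^sup>2"
      by (simp add: power2_eq_square power4_eq_xxxx mult_ac)
    also have "\<dots> \<le> norm A * norm (transpose A) * K ^ 4 * norm D * (real CARD('n) * norm X)"
      using K(1) by (intro mult_left_mono norm_mat_sqrt that) auto
    finally show ?thesis by (simp add: j_def mult_ac)
  qed
  show ?thesis
  proof (rule that[OF a])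
    fix Y l N Q t
    assume path: "mucogarch_path A B C l Y"
      and Q: "\<And>S. finite S \<Longrightarrow> S \<subseteq> {0<..N} \<Longrightarrow> (\<Prod>s\<in>S. 1 + a * (norm (jump l s))\<^sup>2) \<le> Q"
      and t: "0 \<le> t" "t \<le> N"
    have Y: "cadlag Y" "\<And>t. 0 \<le> t \<Longrightarrow> pos_semidef (Y t)"
      and eq: "\<And>t. 0 \<le> t \<Longrightarrow> has_matrix_stieltjes_integral
          (\<lambda>s. A ** mat_sqrt (C + left_limit Y s)) (jump_quad_var l)
          (\<lambda>s. mat_sqrt (C + left_limit Y s) ** transpose A) 0 t
          (Y t - Y 0 - (LINT s:{0..t}|lborel. B ** left_limit Y s + left_limit Y s ** transpose B))"
      using path unfolding mucogarch_path_def by blast+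
    define v where "v s = (norm (jump l s))\<^sup>2" for s
    interpret bounded_jump_products a v N Q
      by unfold_locales (use a Q in \<open>auto simp: v_def jump_def left_limit_def\<close>)
    define W where "W t = a * (t + infsum v {0..t})" for t
    \<comment> \<open>With \<open>norm C\<close> included, \<open>yl\<close> bounds both
      \<open>norm (left_limit Y s)\<close> and \<open>norm (C + left_limit Y s)\<close>, so drift
      and jumps are estimated by the same quantity.\<close>
    define y where "y t = norm (Y t) + norm C" for t
    define yl where "yl t = norm (left_limit Y t) + norm C" for t
    \<comment> \<open>The added 1 makes the comparison strict at time 0, where the other two factors
      equal 1.\<close>
    define u where "u t = (y 0 + 1) * exp (a * t) * jump_prod a v t" for t
    have y_pos: "0 \<le> y s" for s by (simp add: y_def)
    have pd: "pos_def (C + left_limit Y r)" if "0 \<le> r" for r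
      using left_limit_in_closed[OF Y(1) closed_pos_semidef that] Y(2)
      by (intro pos_def_add_pos_semidef C) auto
    have dW: "W t - W s = a * (t - s) + a * infsum v {s<..t}" if "0 \<le> s" "s \<le> t" "t \<le> N" for s t
      using infsum_interval_diff[OF summable that] by (simp add: W_def algebra_simps)
    have infsum_v: "0 \<le> infsum v {s<..t}" for s t
      by (intro infsum_nonneg) (simp add: v_def)
    \<comment> \<open>The estimate on one grid cell: drift and jump parts add up to the two parts of
      the increment of \<open>W\<close>, since \<open>b\<close> and \<open>j\<close> are both at
      most \<open>a\<close>.\<close>
    have step: "norm ((t - s) *\<^sub>R (B ** left_limit Y s + left_limit Y s ** transpose B) +
        (A ** mat_sqrt (C + left_limit Y s) ** (jump_quad_var l t - jump_quad_var l s)) **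
          (mat_sqrt (C + left_limit Y s) ** transpose A)) \<le> yl s * (W t - W s)"
      (is "norm (?d + ?g) \<le> _") if st: "0 \<le> s" "s \<le> t" "t \<le> N" for s t
    proof -
      have "norm ?d \<le> (t - s) * (b * norm (left_limit Y s))"
        using st drift by (simp add: mult_left_mono)
      also have "\<dots> \<le> (t - s) * (a * yl s)"
        using st bj by (intro mult_left_mono mult_mono) (auto simp: a_def yl_def)
      finally have d: "norm ?d \<le> (t - s) * (a * yl s)" .
      have "norm (jump_quad_var l t - jump_quad_var l s) \<le> infsum v {s<..t}"
        using norm_jump_quad_var_diff[of a l N Q s t] bounded_jump_products_axioms st
        unfolding v_def by blast
      then have "norm ?g \<le> j * norm (C + left_limit Y s) * infsum v {s<..t}"
        by (intro order_trans[OF jumps[OF pd[OF st(1)]]] mult_left_mono mult_nonneg_nonneg bj) auto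
      also have "\<dots> \<le> a * yl s * infsum v {s<..t}"
        using bj infsum_v norm_triangle_ineq[of C "left_limit Y s"]
        by (intro mult_right_mono mult_mono) (auto simp: a_def yl_def)
      finally show ?thesis
        using norm_triangle_ineq[of ?d ?g] d unfolding dW[OF st] by (simp add: algebra_simps)
    qed
    have "y t < u t"
    proof (rule stieltjes_gronwall[where y = y and u = u and yl = yl and W = W and N = N])
      show "(y \<longlongrightarrow> y s) (at_right s)" if "0 \<le> s" for s
        unfolding y_def using Y(1) that by (intro tendsto_intros) (simp add: cadlag_def)
      show "(y \<longlongrightarrow> yl s) (at_left s)" if "0 < s" for s
        unfolding y_def yl_def using tendsto_left_limit[OF Y(1) that] by (intro tendsto_intros)
      show "yl 0 = y 0" by (simp add: y_def yl_def left_limit_def)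
      show "W s \<le> W t" if "0 \<le> s" "s \<le> t" "t \<le> N" for s t
      proof -
        have "0 \<le> a * (t - s)" "0 \<le> a * infsum v {s<..t}"
          using a that infsum_v[of s t] by simp_all
        then show ?thesis using dW[OF that] by linarith
      qed
      show "0 \<le> u s" if "0 \<le> s" "s \<le> N" for s
        using jump_prod_ge_1[of s] that y_pos[of 0] by (auto simp: u_def intro!: mult_nonneg_nonneg)
      show "y 0 < u 0" by (simp add: u_def jump_prod_0)
      \<comment> \<open>\<open>1 + x + z\<close> is at most \<open>(1 + x) * (1 + z)\<close>; the
        exponential absorbs the time factor, and \<open>jump_prod_increment\<close> the jump
        factor.\<close>
      show "u s * (1 + (W t - W s)) \<le> u t" if st: "0 \<le> s" "s \<le> t" "t \<le> N" for s t
      proof -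
        define x where "x = a * (t - s)"
        define z where "z = a * infsum v {s<..t}"
        have xz: "0 \<le> x" "0 \<le> z" using a st infsum_v by (auto simp: x_def z_def)
        have P: "0 \<le> jump_prod a v s" using jump_prod_ge_1[of s] st by simp
        have "u s * (1 + (W t - W s)) \<le> u s * ((1 + x) * (1 + z))"
          using xz P y_pos[of 0] unfolding dW[OF st] x_def[symmetric] z_def[symmetric]
          by (intro mult_left_mono) (auto simp: u_def algebra_simps)
        also have "\<dots> = (y 0 + 1) * exp (a * s) * (1 + x) * (jump_prod a v s * (1 + z))"
          by (simp add: u_def mult_ac)
        also have "\<dots> \<le> (y 0 + 1) * exp (a * s) * exp x * jump_prod a v t"
          using xz P y_pos[of 0] jump_prod_increment[OF st] exp_ge_add_one_self[of x]
          by (intro mult_mono mult_left_mono mult_nonneg_nonneg) (auto simp: z_def)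
        also have "\<dots> = u t"
          by (simp add: u_def x_def mult.assoc flip: exp_add) (simp add: algebra_simps)
        finally show ?thesis .
      qed
      \<comment> \<open>Both integrals are approximated on the same grid, so that
        \<open>step\<close> applies to the sum of the two contributions of each cell.\<close>
      show "\<exists>n. y r \<le> y 0 + (\<Sum>i<Suc n. yl (grid r n i) * (W (grid r n (Suc i)) - W (grid r n i))) + e"
        if r: "0 < r" "r \<le> N" and e: "0 < e" for r e
      proof -
        let ?g = "\<lambda>s. B ** left_limit Y s + left_limit Y s ** transpose B"
        let ?R = "\<lambda>s. mat_sqrt (C + left_limit Y s)"
        let ?H = "\<lambda>s. A ** ?R s" and ?K = "\<lambda>s. ?R s ** transpose A"
        have "bounded (left_limit Y ` {0..r})"
        proof -
          obtain c where c: "\<forall>x\<in>Y ` {0..r}. norm x \<le> c"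
            using cadlag_bounded[OF Y(1) less_imp_le[OF r(1)]] unfolding bounded_iff by (rule exE)
          have "left_limit Y s \<in> cball 0 c" if "s \<in> {0..r}" for s
            using that c by (intro left_limit_in_closed[OF Y(1)]) auto
          then show ?thesis by (intro bounded_subset[OF bounded_cball, of _ 0 c]) auto
        qed
        then obtain c where "\<forall>x\<in>left_limit Y ` {0..r}. norm x \<le> c"
          unfolding bounded_iff by (rule exE)
        then have c: "norm (left_limit Y s) \<le> c" if "s \<in> {0..r}" for s
          using that by simp
        have "bounded (?g ` {0..r})"
          unfolding bounded_iff
          using c bj by (intro exI[of _ "b * c"]) (auto intro!: order_trans[OF drift] mult_left_mono)
        have R_bound: "norm (?R s) \<le> sqrt (real CARD('n) * (norm C + c))" if "s \<in> {0..r}" for s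
        proof (rule real_le_rsqrt, rule order_trans[OF norm_mat_sqrt])
          show "pos_def (C + left_limit Y s)" using that by (intro pd) auto
          show "real CARD('n) * norm (C + left_limit Y s) \<le> real CARD('n) * (norm C + c)"
            using c[OF that] norm_triangle_ineq[of C "left_limit Y s"] by (intro mult_left_mono) auto
        qed
        have R_bd: "bounded (?R ` {0..r})"
          unfolding bounded_iff using R_bound by blast
        have R_lim: "(?R \<longlongrightarrow> ?R s) (at_left s)" if "0 < s" for s
          by (rule tendsto_mat_sqrt_left_limit[OF C Y that])
        let ?J = "\<lambda>n. \<Sum>m<Suc n. (?H (grid r n m) **
          (jump_quad_var l (grid r n (Suc m)) - jump_quad_var l (grid r n m))) ** ?K (grid r n m)"
        let ?D = "\<lambda>n. \<Sum>m<Suc n. (grid r n (Suc m) - grid r n m) *\<^sub>R ?g (grid r n m)"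
        have "?J \<longlonglongrightarrow> Y r - Y 0 - (LINT s:{0..r}|lborel. ?g s)"
        proof (rule has_matrix_stieltjes_integral_riemann[OF eq[OF less_imp_le[OF r(1)]] r(1)])
          show "bounded (?H ` {0..r})" "bounded (?K ` {0..r})"
            using bounded_linear_image[OF R_bd bounded_bilinear.bounded_linear_right[OF bounded_bilinear_matrix_mult, of A]]
              bounded_linear_image[OF R_bd bounded_bilinear.bounded_linear_left[OF bounded_bilinear_matrix_mult, of "transpose A"]]
            by (simp_all add: image_image)
        qed (intro bounded_bilinear.tendsto[OF bounded_bilinear_matrix_mult] R_lim tendsto_const; assumption)+
        moreover have "?D \<longlonglongrightarrow> (LINT s:{0..r}|lborel. ?g s)"
        proof -
          have "(\<lambda>n. \<Sum>m<Suc n. measure lborel {grid r n m<..grid r n (Suc m)} *\<^sub>R ?g (grid r n m))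
             \<longlonglongrightarrow> (LINT s:{0<..r}|lborel. ?g s)"
          proof (rule left_continuous_riemann)
            show "(?g \<longlongrightarrow> ?g s) (at_left s)" if "0 < s" for s
              by (intro tendsto_add bounded_bilinear.tendsto[OF bounded_bilinear_matrix_mult] tendsto_const
                  left_limit_left_continuous[OF Y(1) that])
          qed (use r \<open>bounded (?g ` {0..r})\<close> in auto)
          moreover have "measure lborel {grid r n m<..grid r n (Suc m)} = grid r n (Suc m) - grid r n m" for n m
            using grid_mono[of r m "Suc m" n] r by simp
          moreover have "(LINT s:{0<..r}|lborel. ?g s) = (LINT s:{0..r}|lborel. ?g s)"
            unfolding set_lebesgue_integral_def
            by (rule integral_discrete_difference[of "{0}"]) (auto simp: indicator_def)
          ultimately show ?thesis by simp
        qed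
        ultimately have "(\<lambda>n. ?D n + ?J n) \<longlonglongrightarrow> Y r - Y 0"
          using tendsto_add by fastforce
        then have "\<forall>\<^sub>F n in sequentially. dist (?D n + ?J n) (Y r - Y 0) < e"
          using e by (rule tendstoD)
        then obtain n where n: "dist (?D n + ?J n) (Y r - Y 0) < e"
          by (auto simp: eventually_sequentially)
        have "norm (?D n + ?J n) \<le> (\<Sum>i<Suc n. yl (grid r n i) * (W (grid r n (Suc i)) - W (grid r n i)))"
          unfolding sum.distrib[symmetric]
        proof (intro sum_norm_le step)
          fix i assume "i \<in> {..<Suc n}"
          then show "0 \<le> grid r n i" "grid r n i \<le> grid r n (Suc i)" "grid r n (Suc i) \<le> N"
            using grid_bounds[of r i n] grid_bounds[of r "Suc i" n] grid_mono[of r i "Suc i" n] r by auto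
        qed
        moreover have "norm (Y r) \<le> norm (Y 0) + norm (?D n + ?J n) + e"
          using n norm_triangle_ineq[of "Y 0" "?D n + ?J n"]
            norm_triangle_ineq[of "Y 0 + (?D n + ?J n)" "Y r - (Y 0 + (?D n + ?J n))"]
          unfolding dist_norm by (simp add: norm_minus_commute algebra_simps)
        ultimately show ?thesis
          unfolding y_def by (intro exI[of _ n]) linarith
      qed
    qed (use t in auto)
    also have "u t \<le> (y 0 + 1) * exp (a * N) * Q"
      unfolding u_def using t a y_pos[of 0] jump_prod_le[OF t(2)] jump_prod_ge_1[OF t(2)]
      by (intro mult_mono mult_nonneg_nonneg) auto
    finally show "norm (Y t) \<le> (norm (Y 0) + norm C + 1) * exp (a * N) * Q"
      using norm_ge_zero[of C] unfolding y_def by linarith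
  qed
qed

section \<open>Moments of a Levy process over dyadic times\<close>

lemma power_add_le_two_power:
  fixes x y :: real
  assumes "0 \<le> x" "0 \<le> y"
  shows "(x + y) ^ n \<le> 2 ^ n * (x ^ n + y ^ n)"
proof -
  have "(x + y) ^ n \<le> (2 * max x y) ^ n"
    using assms by (intro power_mono) auto
  also have "\<dots> \<le> 2 ^ n * (x ^ n + y ^ n)"
    using assms unfolding power_mult_distrib by (intro mult_left_mono) (auto simp: max_def)
  finally show ?thesis .
qed

lemma sum_power_le:
  fixes f :: "'b \<Rightarrow> real"
  assumes "finite S" "S \<noteq> {}" "\<And>i. i \<in> S \<Longrightarrow> 0 \<le> f i"
  shows "(sum f S) ^ n \<le> real (card S) ^ n * (\<Sum>i\<in>S. f i ^ n)"
proof -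
  have "Max (f ` S) \<in> f ` S"
    using assms(1,2) by (intro Max_in) auto
  then obtain m where m: "m \<in> S" "f m = Max (f ` S)"
    by auto
  have "sum f S \<le> real (card S) * f m"
    using sum_bounded_above[of S f "f m"] m assms(1) by simp
  then have "(sum f S) ^ n \<le> (real (card S) * f m) ^ n"
    using assms(3) by (intro power_mono sum_nonneg) auto
  also have "\<dots> \<le> real (card S) ^ n * (\<Sum>i\<in>S. f i ^ n)"
    unfolding power_mult_distrib using assms m(1)
    by (intro mult_left_mono member_le_sum) auto
  finally show ?thesis .
qed

lemma power_le_add_power:
  fixes z :: real
  assumes "0 \<le> z" "1 \<le> j" "j \<le> m"
  shows "z ^ j \<le> z + z ^ m"
proof (cases "z \<le> 1")
  case True
  then have "z ^ j \<le> z ^ 1" using assms by (intro power_decreasing) auto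
  then show ?thesis using assms(1) by (simp add: add_increasing2)
next
  case False
  then have "z ^ j \<le> z ^ m" using assms by (intro power_increasing) auto
  then show ?thesis using assms(1) by simp
qed

text \<open>The constant term stays exactly 1. This is indispensable because the expectation is
  later raised to the power \<open>N * 2 ^ n\<close>; and only the extreme powers of
  \<open>z\<close> remain, so only two moments have to be controlled.\<close>

lemma one_plus_power_le:
  fixes z :: real
  assumes "0 \<le> z"
  shows "(1 + z) ^ Suc n \<le> 1 + 4 ^ Suc n * (z + z ^ Suc n)"
proof (induction n)
  case (Suc n)
  have "(1 + z) ^ Suc (Suc n) \<le> (1 + z) * (1 + 4 ^ Suc n * (z + z ^ Suc n))"
    using assms Suc by (simp only: power_Suc[of _ "Suc n"]) (intro mult_left_mono, auto)
  also have "\<dots> = 1 + z + 4 ^ Suc n * (z + z ^ Suc n + z ^ 2 + z ^ Suc (Suc n))"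
    by (simp add: algebra_simps power2_eq_square)
  \<comment> \<open>One share of \<open>4 ^ Suc n\<close> absorbs the lone \<open>z\<close> and
    three shares the four monomials, whence the base 4.\<close>
  also have "\<dots> \<le> 1 + 4 ^ Suc n * (z + z ^ Suc (Suc n)) + 4 ^ Suc n * (3 * (z + z ^ Suc (Suc n)))"
  proof -
    have "1 * z \<le> 4 ^ Suc n * (z + z ^ Suc (Suc n))"
      using assms one_le_power[of "4 :: real" "Suc n"] by (intro mult_mono) auto
    moreover have "z + z ^ Suc n + z ^ 2 + z ^ Suc (Suc n) \<le> 3 * (z + z ^ Suc (Suc n))"
      using power_le_add_power[OF assms, of "Suc n" "Suc (Suc n)"]
        power_le_add_power[OF assms, of 2 "Suc (Suc n)"] by simp
    then have "4 ^ Suc n * (z + z ^ Suc n + z ^ 2 + z ^ Suc (Suc n)) \<le> 4 ^ Suc n * (3 * (z + z ^ Suc (Suc n)))"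
      by (intro mult_left_mono) auto
    ultimately show ?thesis by linarith
  qed
  finally show ?case by (simp add: algebra_simps)
qed (use assms in simp)

text \<open>The recursion is that of \<open>E(X\<^sub>h ^ j)\<close> with \<open>h = 1 / 2 ^ n\<close>: apart from \<open>2 m (n + 1) j\<close>, all
  summands are products of two lower moments, hence \<open>O(h\<^sup>2)\<close>, and \<open>2 ^ n m n j\<close> stays bounded.\<close>

lemma dyadic_moments_bound:
  fixes m :: "nat \<Rightarrow> nat \<Rightarrow> real"
  assumes m0: "\<And>n. m n 0 = 1"
    and rec: "\<And>n j. j \<le> p \<Longrightarrow> m n j = (\<Sum>r\<le>j. real (j choose r) * m (Suc n) r * m (Suc n) (j - r))"
    and j: "1 \<le> j" "j \<le> p"
  shows "\<exists>K\<ge>0. \<forall>n. \<bar>m n j\<bar> \<le> K / 2 ^ n"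
  using j
proof (induction j rule: less_induct)
  case (less j)
  then have "\<forall>r\<in>{1..<j}. \<exists>K\<ge>0. \<forall>n. \<bar>m n r\<bar> \<le> K / 2 ^ n" by auto
  then obtain K where K: "\<And>r. r \<in> {1..<j} \<Longrightarrow> 0 \<le> K r" "\<And>r n. r \<in> {1..<j} \<Longrightarrow> \<bar>m n r\<bar> \<le> K r / 2 ^ n"
    by (metis (no_types, lifting) bchoice)
  define c where "c = (\<Sum>r\<in>{1..<j}. real (j choose r) * (K r * K (j - r)))"
  have c: "0 \<le> c" unfolding c_def
    by (intro sum_nonneg mult_nonneg_nonneg K(1)) auto
  have step: "\<bar>m n j - 2 * m (Suc n) j\<bar> \<le> c / (2 ^ Suc n * 2 ^ Suc n)" for n
  proof -
    have "{..j} = insert 0 (insert j {1..<j})" using less.prems by auto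
    then have "m n j = 2 * m (Suc n) j + (\<Sum>r\<in>{1..<j}. real (j choose r) * m (Suc n) r * m (Suc n) (j - r))"
      using less.prems by (subst rec) (simp_all add: m0)
    then have "\<bar>m n j - 2 * m (Suc n) j\<bar> \<le> (\<Sum>r\<in>{1..<j}. \<bar>real (j choose r) * m (Suc n) r * m (Suc n) (j - r)\<bar>)"
      by simp
    also have "\<dots> \<le> (\<Sum>r\<in>{1..<j}. real (j choose r) * (K r / 2 ^ Suc n * (K (j - r) / 2 ^ Suc n)))"
    proof (rule sum_mono)
      fix r assume r: "r \<in> {1..<j}"
      then have r': "j - r \<in> {1..<j}" by auto
      show "\<bar>real (j choose r) * m (Suc n) r * m (Suc n) (j - r)\<bar>
        \<le> real (j choose r) * (K r / 2 ^ Suc n * (K (j - r) / 2 ^ Suc n))"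
        unfolding abs_mult mult.assoc
        using K(1)[OF r] K(2)[OF r, of "Suc n"] K(2)[OF r', of "Suc n"]
        by (intro mult_mono) auto
    qed
    also have "\<dots> = c / (2 ^ Suc n * 2 ^ Suc n)"
      by (simp add: c_def sum_divide_distrib)
    finally show ?thesis .
  qed
  \<comment> \<open>The factor \<open>1 - 1 / 2 ^ n\<close> leaves room for the errors still to
    come, which are summable as a geometric series; with \<open>c\<close> alone the induction would
    not close.\<close>
  have "2 ^ n * \<bar>m n j\<bar> \<le> \<bar>m 0 j\<bar> + c * (1 - 1 / 2 ^ n)" for n
  proof (induction n)
    case (Suc n)
    have "2 * \<bar>m (Suc n) j\<bar> \<le> \<bar>m n j\<bar> + c / (2 ^ Suc n * 2 ^ Suc n)"
      using step[of n] by linarith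
    then have "2 ^ n * (2 * \<bar>m (Suc n) j\<bar>) \<le> 2 ^ n * (\<bar>m n j\<bar> + c / (2 ^ Suc n * 2 ^ Suc n))"
      by (intro mult_left_mono) auto
    also have "\<dots> = 2 ^ n * \<bar>m n j\<bar> + c / 4 / 2 ^ n"
      by (simp add: field_simps)
    also have "\<dots> \<le> \<bar>m 0 j\<bar> + c * (1 - 1 / 2 ^ n) + c / 2 / 2 ^ n"
      using c by (intro add_mono Suc.IH divide_right_mono) auto
    also have "\<dots> = \<bar>m 0 j\<bar> + c * (1 - 1 / 2 ^ Suc n)"
      by (simp add: field_simps)
    finally show ?case by simp
  qed simp
  moreover have "c * (1 - 1 / 2 ^ n) \<le> c" for n
    using c by (simp add: mult_left_le)
  ultimately have "2 ^ n * \<bar>m n j\<bar> \<le> \<bar>m 0 j\<bar> + c" for n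
    by (meson add_left_mono order_trans)
  then have "\<bar>m n j\<bar> \<le> (\<bar>m 0 j\<bar> + c) / 2 ^ n" for n
    by (simp add: field_simps)
  then show ?case using c by (intro exI[of _ "\<bar>m 0 j\<bar> + c"]) auto
qed

section \<open>Integrability of an independent summand\<close>

lemma (in prob_space) indep_var_nn_integral_mult:
  assumes "indep_var borel X borel (Y :: 'a \<Rightarrow> ennreal)"
  shows "(\<integral>\<^sup>+\<omega>. X \<omega> * Y \<omega> \<partial>M) = (\<integral>\<^sup>+\<omega>. X \<omega> \<partial>M) * (\<integral>\<^sup>+\<omega>. Y \<omega> \<partial>M)"
proof -
  have "(\<lambda>_. borel) = case_bool borel borel" by (auto split: bool.splits)
  then have "indep_vars (\<lambda>_. borel) (case_bool X Y) UNIV"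
    using assms unfolding indep_var_def by (subst \<open>(\<lambda>_. borel) = case_bool borel borel\<close>)
  from indep_vars_nn_integral[OF _ this] show ?thesis
    by (simp add: UNIV_bool mult.commute)
qed

text \<open>Some event \<open>norm (D \<omega>) \<le> c\<close> has positive probability, and on it
  \<open>norm (X \<omega>)\<close> is at most \<open>norm (X \<omega> + D \<omega>) + c\<close>. By
  independence, restricting to this event merely multiplies the moment of \<open>X\<close> by that
  probability.\<close>

lemma (in prob_space) integrable_indep_summand:
  fixes X D :: "'a \<Rightarrow> 'b :: euclidean_space"
  assumes ind: "indep_var borel X borel D"
    and int: "integrable M (\<lambda>\<omega>. norm (X \<omega> + D \<omega>) ^ p)"
  shows "integrable M (\<lambda>\<omega>. norm (X \<omega>) ^ p)"
proof -
  have [measurable]: "X \<in> borel_measurable M" "D \<in> borel_measurable M"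
    using ind by (auto dest: indep_var_rv1 indep_var_rv2)
  obtain c :: nat where c: "0 < emeasure M {\<omega> \<in> space M. norm (D \<omega>) \<le> real c}"
  proof (rule ccontr)
    assume "\<not> thesis"
    then have "\<And>c. emeasure M {\<omega> \<in> space M. norm (D \<omega>) \<le> real c} = 0"
      using that by (metis zero_less_iff_neq_zero)
    then have "emeasure M (\<Union>c. {\<omega> \<in> space M. norm (D \<omega>) \<le> real c}) = 0"
      by (intro emeasure_UN_eq_0) auto
    also have "(\<Union>c. {\<omega> \<in> space M. norm (D \<omega>) \<le> real c}) = space M"
      using real_arch_simple by auto
    finally show False using emeasure_space_1 by simp
  qed
  define E where "E = {\<omega> \<in> space M. norm (D \<omega>) \<le> real c}"
  define q where "q = emeasure M E"
  have [measurable]: "E \<in> sets M" unfolding E_def by measurable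
  have "indep_var borel ((\<lambda>x. ennreal (norm x ^ p)) \<circ> X) borel ((\<lambda>d. indicator (cball 0 (real c)) d) \<circ> D)"
    by (rule indep_var_compose[OF ind])
      (auto intro!: borel_measurable_indicator borel_closed)
  from indep_var_nn_integral_mult[OF this]
  have "(\<integral>\<^sup>+\<omega>. ennreal (norm (X \<omega>) ^ p) * indicator (cball 0 (real c)) (D \<omega>) \<partial>M)
      = (\<integral>\<^sup>+\<omega>. ennreal (norm (X \<omega>) ^ p) \<partial>M) * (\<integral>\<^sup>+\<omega>. indicator (cball 0 (real c)) (D \<omega>) \<partial>M)"
    by simp
  also have "(\<integral>\<^sup>+\<omega>. indicator (cball 0 (real c)) (D \<omega>) \<partial>M) = (\<integral>\<^sup>+\<omega>. indicator E \<omega> \<partial>M)"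
    by (intro nn_integral_cong) (auto simp: E_def indicator_def)
  also have "\<dots> = q" by (simp add: q_def)
  finally have eq: "(\<integral>\<^sup>+\<omega>. ennreal (norm (X \<omega>) ^ p) * indicator (cball 0 (real c)) (D \<omega>) \<partial>M)
      = (\<integral>\<^sup>+\<omega>. ennreal (norm (X \<omega>) ^ p) \<partial>M) * q" .
  have int': "integrable M (\<lambda>\<omega>. 2 ^ p * (norm (X \<omega> + D \<omega>) ^ p + real c ^ p))"
    using int by auto
  have "(\<integral>\<^sup>+\<omega>. ennreal (norm (X \<omega>) ^ p) * indicator (cball 0 (real c)) (D \<omega>) \<partial>M)
      \<le> (\<integral>\<^sup>+\<omega>. ennreal (2 ^ p * (norm (X \<omega> + D \<omega>) ^ p + real c ^ p)) \<partial>M)"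
  proof (rule nn_integral_mono)
    fix \<omega>
    have "norm (X \<omega>) ^ p \<le> 2 ^ p * (norm (X \<omega> + D \<omega>) ^ p + real c ^ p)" if "norm (D \<omega>) \<le> real c"
    proof -
      have "norm (X \<omega>) \<le> norm (X \<omega> + D \<omega>) + real c"
        using norm_triangle_ineq4[of "X \<omega> + D \<omega>" "D \<omega>"] that by simp
      then have "norm (X \<omega>) ^ p \<le> (norm (X \<omega> + D \<omega>) + real c) ^ p"
        by (intro power_mono) auto
      then show ?thesis
        using power_add_le_two_power[of "norm (X \<omega> + D \<omega>)" "real c" p] by simp
    qed
    then show "ennreal (norm (X \<omega>) ^ p) * indicator (cball 0 (real c)) (D \<omega>)
      \<le> ennreal (2 ^ p * (norm (X \<omega> + D \<omega>) ^ p + real c ^ p))"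
      by (auto simp: indicator_def intro!: ennreal_leI)
  qed
  also have "\<dots> < \<infinity>"
    by (subst nn_integral_eq_integral[OF int']) auto
  finally have "(\<integral>\<^sup>+\<omega>. ennreal (norm (X \<omega>) ^ p) \<partial>M) < \<infinity>"
    unfolding eq using c by (auto simp: q_def E_def ennreal_mult_less_top)
  then show ?thesis
    by (intro integrableI_bounded) (auto simp: abs_of_nonneg)
qed

section \<open>Moments and products of Levy increments\<close>

context usual_filtered_prob_space
begin

lemma space_F: "0 \<le> t \<Longrightarrow> space (F t) = space M"
  using subalgebra_F[of t] by (simp add: subalgebra_def)

lemma measurable_F_mono:
  assumes "f \<in> measurable (F s) N" "0 \<le> s" "s \<le> t"
  shows "f \<in> measurable (F t) N"
  by (rule measurable_from_subalg[OF _ assms(1)])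
    (use assms space_F F_mono[of s t] in \<open>auto simp: subalgebra_def\<close>)

lemma measurable_F_M: "f \<in> measurable (F s) N \<Longrightarrow> 0 \<le> s \<Longrightarrow> f \<in> measurable M N"
  by (rule measurable_from_subalg[OF subalgebra_F])

lemma levy_measurable: "levy_process L \<Longrightarrow> 0 \<le> t \<Longrightarrow> L t \<in> borel_measurable (F t)"
  by (simp add: levy_process_def adapted_def)

text \<open>\<open>Z\<close> may be any \<open>F s\<close>-measurable variable: later it combines
  the initial value with all earlier increments.\<close>

lemma indep_var_increment:
  fixes L :: "real \<Rightarrow> 'a \<Rightarrow> real ^ 'n"
  assumes L: "levy_process L" and Z: "Z \<in> measurable (F s) N" and \<phi> [measurable]: "\<phi> \<in> measurable borel N'"
    and st: "0 \<le> s" "s \<le> t"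
  shows "indep_var N Z N' (\<lambda>\<omega>. \<phi> (L t \<omega> - L s \<omega>))"
proof -
  let ?D = "\<lambda>\<omega>. L t \<omega> - L s \<omega>"
  have [measurable]: "L s \<in> borel_measurable M" "L t \<in> borel_measurable M"
    using st by (auto intro!: measurable_F_M[OF levy_measurable[OF L]])
  have "indep_set (sets (F s)) (sets (vimage_algebra (space M) ?D borel))"
    using L st by (simp add: levy_process_def)
  moreover have "sigma_sets (space M) {Z -` A \<inter> space M |A. A \<in> sets N} \<subseteq> sets (F s)"
  proof -
    have "{Z -` A \<inter> space M |A. A \<in> sets N} \<subseteq> sets (F s)"
      using measurable_sets[OF Z] space_F[OF st(1)] by auto
    from sets.sigma_sets_subset[OF this] show ?thesis
      by (simp only: space_F[OF st(1)])
  qed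
  moreover have "sigma_sets (space M) {(\<lambda>\<omega>. \<phi> (?D \<omega>)) -` A \<inter> space M |A. A \<in> sets N'}
      \<subseteq> sets (vimage_algebra (space M) ?D borel)"
  proof -
    let ?V = "vimage_algebra (space M) ?D borel"
    have "(\<lambda>\<omega>. \<phi> (?D \<omega>)) \<in> measurable ?V N'"
      by (rule measurable_compose[OF measurable_vimage_algebra1 \<phi>]) simp
    then have "{(\<lambda>\<omega>. \<phi> (?D \<omega>)) -` A \<inter> space M |A. A \<in> sets N'} \<subseteq> sets ?V"
      using measurable_sets[of "\<lambda>\<omega>. \<phi> (?D \<omega>)" ?V N'] by auto
    from sets.sigma_sets_subset[OF this] show ?thesis
      by (simp only: space_vimage_algebra)
  qed
  ultimately have "indep_set (sigma_sets (space M) {Z -` A \<inter> space M |A. A \<in> sets N})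
      (sigma_sets (space M) {(\<lambda>\<omega>. \<phi> (?D \<omega>)) -` A \<inter> space M |A. A \<in> sets N'})"
    unfolding indep_set_def by (elim indep_sets_mono_sets) (auto split: bool.splits)
  moreover have "(\<lambda>\<omega>. \<phi> (?D \<omega>)) \<in> measurable M N'"
    by measurable
  ultimately show ?thesis
    using measurable_F_M[OF Z st(1)] by (simp add: indep_var_eq)
qed

lemma distr_increment:
  "levy_process L \<Longrightarrow> 0 \<le> s \<Longrightarrow> s \<le> t \<Longrightarrow>
    distr M borel (\<lambda>\<omega>. L t \<omega> - L s \<omega>) = distr M borel (L (t - s))"
  by (simp add: levy_process_def)

text \<open>Halving the time exhibits the value at \<open>h\<close> as an independent summand of the
  value at \<open>2 * h\<close>, so integrability descends from time 1.\<close>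

lemma integrable_levy_dyadic:
  fixes L :: "real \<Rightarrow> 'a \<Rightarrow> real ^ 'n"
  assumes L: "levy_process L" and int: "integrable M (\<lambda>\<omega>. norm (L 1 \<omega>) ^ p)"
  shows "integrable M (\<lambda>\<omega>. norm (L (1 / 2 ^ n) \<omega>) ^ p)"
proof (induction n)
  case (Suc n)
  define h :: real where "h = 1 / 2 ^ Suc n"
  have h: "0 \<le> h" "1 / 2 ^ n = 2 * h" by (auto simp: h_def)
  have ind: "indep_var borel (L h) borel (\<lambda>\<omega>. L (2 * h) \<omega> - L h \<omega>)"
    by (rule indep_var_increment[OF L levy_measurable[OF L], where \<phi> = "\<lambda>x. x"]) (use h in simp_all)
  have "integrable M (\<lambda>\<omega>. norm (L h \<omega> + (L (2 * h) \<omega> - L h \<omega>)) ^ p)"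
    using Suc by (simp add: h(2))
  from integrable_indep_summand[OF ind this] show ?case
    by (simp only: h_def)
qed (use int in simp)

lemma integrable_levy_component:
  fixes L :: "real \<Rightarrow> 'a \<Rightarrow> real ^ 'n"
  assumes L: "levy_process L" and int: "integrable M (\<lambda>\<omega>. norm (L 1 \<omega>) ^ p)" and j: "j \<le> p"
  shows "integrable M (\<lambda>\<omega>. (L (1 / 2 ^ n) \<omega> $ i) ^ j)"
proof (rule Bochner_Integration.integrable_bound)
  have [measurable]: "(\<lambda>x :: real ^ 'n. x $ i) \<in> borel_measurable borel"
    by (intro borel_measurable_continuous_onI continuous_intros)
  have [measurable]: "L (1 / 2 ^ n) \<in> borel_measurable M"
    by (rule measurable_F_M[OF levy_measurable[OF L]]) auto
  show "integrable M (\<lambda>\<omega>. 1 + norm (L (1 / 2 ^ n) \<omega>) ^ p)"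
    using integrable_levy_dyadic[OF L int] by auto
  show "(\<lambda>\<omega>. (L (1 / 2 ^ n) \<omega> $ i) ^ j) \<in> borel_measurable M" by measurable
  have "\<bar>x $ i\<bar> ^ j \<le> 1 + norm x ^ p" for x :: "real ^ 'n"
  proof -
    have "\<bar>x $ i\<bar> ^ j \<le> norm x ^ j" by (intro power_mono component_le_norm_cart) auto
    also have "\<dots> \<le> 1 + norm x ^ p"
    proof (cases "norm x \<le> 1")
      case True
      then have "norm x ^ j \<le> 1" by (intro power_le_one) auto
      then show ?thesis by (simp add: add_increasing2)
    next
      case False
      then have "norm x ^ j \<le> norm x ^ p" using j by (intro power_increasing) auto
      then show ?thesis by simp
    qed
    finally show ?thesis .
  qed
  then show "AE \<omega> in M. norm ((L (1 / 2 ^ n) \<omega> $ i) ^ j) \<le> norm (1 + norm (L (1 / 2 ^ n) \<omega>) ^ p)"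
    by (intro AE_I2) (simp add: power_abs abs_of_nonneg)
qed

text \<open>Binomial expansion of \<open>(X + D) ^ j\<close>, with \<open>D\<close> independent of
  \<open>X\<close> and of the same law, gives the recursion of \<open>dyadic_moments_bound\<close>.
  Signed powers of one component are used since norms admit no such identity.\<close>

lemma levy_dyadic_moments:
  fixes L :: "real \<Rightarrow> 'a \<Rightarrow> real ^ 'n"
  assumes L: "levy_process L" and int: "integrable M (\<lambda>\<omega>. norm (L 1 \<omega>) ^ p)"
    and j: "1 \<le> j" "j \<le> p"
  shows "\<exists>K\<ge>0. \<forall>n. \<bar>expectation (\<lambda>\<omega>. (L (1 / 2 ^ n) \<omega> $ i) ^ j)\<bar> \<le> K / 2 ^ n"
proof -
  define m where "m n j = expectation (\<lambda>\<omega>. (L (1 / 2 ^ n) \<omega> $ i) ^ j)" for n j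
  have meas [measurable]: "L t \<in> borel_measurable M" if "0 \<le> t" for t
    using levy_measurable[OF L that] by (rule measurable_F_M[OF _ that])
  have [measurable]: "(\<lambda>x :: real ^ 'n. x $ i) \<in> borel_measurable borel"
    by (intro borel_measurable_continuous_onI continuous_intros)
  note int_j = integrable_levy_component[OF L int]
  have "\<exists>K\<ge>0. \<forall>n. \<bar>m n j\<bar> \<le> K / 2 ^ n"
  proof (rule dyadic_moments_bound[OF _ _ j])
    show "m n 0 = 1" for n by (simp add: m_def prob_space)
    fix n j assume "j \<le> p"
    define h :: real where "h = 1 / 2 ^ Suc n"
    have h: "0 \<le> h" "1 / 2 ^ n = 2 * h" by (auto simp: h_def)
    define X where "X = L h"
    define D where "D \<omega> = L (2 * h) \<omega> - L h \<omega>" for \<omega>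
    have ind: "indep_var borel X borel D"
      unfolding X_def D_def
      by (rule indep_var_increment[OF L levy_measurable[OF L], where \<phi> = "\<lambda>x. x"]) (use h in simp_all)
    have [measurable]: "X \<in> borel_measurable M" "D \<in> borel_measurable M"
      using ind by (auto dest: indep_var_rv1 indep_var_rv2)
    have dist: "distr M borel D = distr M borel X"
      unfolding D_def X_def using distr_increment[OF L, of h "2 * h"] h by simp
    have intX: "integrable M (\<lambda>\<omega>. (X \<omega> $ i) ^ r)" if "r \<le> p" for r
      using int_j[OF that, of "Suc n"] by (simp only: X_def h_def)
    have intD: "integrable M (\<lambda>\<omega>. (D \<omega> $ i) ^ r)" if "r \<le> p" for r
    proof -
      have "integrable (distr M borel X) (\<lambda>x. (x $ i) ^ r)"
        using intX[OF that] by (subst integrable_distr_eq) auto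
      then show ?thesis unfolding dist[symmetric] by (subst (asm) integrable_distr_eq) auto
    qed
    have ED: "expectation (\<lambda>\<omega>. (D \<omega> $ i) ^ r) = m (Suc n) r" for r
    proof -
      have "expectation (\<lambda>\<omega>. (D \<omega> $ i) ^ r) = (\<integral>x. (x $ i) ^ r \<partial>distr M borel D)"
        by (subst integral_distr) auto
      also have "\<dots> = expectation (\<lambda>\<omega>. (X \<omega> $ i) ^ r)"
        unfolding dist by (subst integral_distr) auto
      finally show ?thesis by (simp only: m_def X_def h_def)
    qed
    have EX: "expectation (\<lambda>\<omega>. (X \<omega> $ i) ^ r) = m (Suc n) r" for r
      by (simp only: m_def X_def h_def)
    have ind': "indep_var borel (\<lambda>\<omega>. (X \<omega> $ i) ^ r) borel (\<lambda>\<omega>. (D \<omega> $ i) ^ q)" for r q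
      using indep_var_compose[OF ind, of "\<lambda>x. (x $ i) ^ r" borel "\<lambda>x. (x $ i) ^ q" borel]
      by (simp add: o_def)
    have "m n j = expectation (\<lambda>\<omega>. (X \<omega> $ i + D \<omega> $ i) ^ j)"
      by (simp add: m_def h(2) X_def D_def)
    also have "\<dots> = expectation (\<lambda>\<omega>. \<Sum>r\<le>j. real (j choose r) * ((X \<omega> $ i) ^ r * (D \<omega> $ i) ^ (j - r)))"
      by (simp add: binomial_ring mult.assoc)
    also have "\<dots> = (\<Sum>r\<le>j. expectation (\<lambda>\<omega>. real (j choose r) * ((X \<omega> $ i) ^ r * (D \<omega> $ i) ^ (j - r))))"
      using \<open>j \<le> p\<close>
      by (intro Bochner_Integration.integral_sum integrable_mult_right indep_var_integrable ind' intX intD) auto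
    also have "\<dots> = (\<Sum>r\<le>j. real (j choose r) * m (Suc n) r * m (Suc n) (j - r))"
    proof (rule sum.cong)
      fix r assume "r \<in> {..j}"
      then have "expectation (\<lambda>\<omega>. (X \<omega> $ i) ^ r * (D \<omega> $ i) ^ (j - r)) = m (Suc n) r * m (Suc n) (j - r)"
        using \<open>j \<le> p\<close> by (subst indep_var_lebesgue_integral[OF ind' intX intD]) (auto simp: EX ED)
      then show "expectation (\<lambda>\<omega>. real (j choose r) * ((X \<omega> $ i) ^ r * (D \<omega> $ i) ^ (j - r)))
          = real (j choose r) * m (Suc n) r * m (Suc n) (j - r)"
        by simp
    qed simp
    finally show "m n j = (\<Sum>r\<le>j. real (j choose r) * m (Suc n) r * m (Suc n) (j - r))" .
  qed
  then show ?thesis by (simp add: m_def)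
qed

text \<open>\<open>one_plus_power_le\<close> leaves the first and \<open>k\<close>-th powers of
  \<open>a * (norm x)^2\<close>, which are controlled by powers of order 2 and \<open>2 * k\<close>
  of the components. These are even, so bounds on signed moments suffice.\<close>

lemma levy_dyadic_factor:
  fixes L :: "real \<Rightarrow> 'a \<Rightarrow> real ^ 'n"
  assumes L: "levy_process L" and int: "integrable M (\<lambda>\<omega>. norm (L 1 \<omega>) ^ (2 * k))"
    and k: "1 \<le> k" and a: "0 \<le> a"
  shows "\<exists>K\<ge>0. \<forall>n. (\<integral>\<^sup>+\<omega>. ennreal ((1 + a * (norm (L (1 / 2 ^ n) \<omega>))\<^sup>2) ^ k) \<partial>M) \<le> ennreal (1 + K / 2 ^ n)"
proof -
  define m where "m n i j = expectation (\<lambda>\<omega>. (L (1 / 2 ^ n) \<omega> $ i) ^ j)" for n i j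
  have "\<forall>i. \<exists>K\<ge>0. \<forall>n. \<bar>m n i 2\<bar> \<le> K / 2 ^ n"
    unfolding m_def using k by (intro allI levy_dyadic_moments[OF L int]) auto
  then obtain K2 where K2: "\<And>i. 0 \<le> K2 i" "\<And>i n. \<bar>m n i 2\<bar> \<le> K2 i / 2 ^ n"
    by metis
  have "\<forall>i. \<exists>K\<ge>0. \<forall>n. \<bar>m n i (2 * k)\<bar> \<le> K / 2 ^ n"
    unfolding m_def using k by (intro allI levy_dyadic_moments[OF L int]) auto
  then obtain Kk where Kk: "\<And>i. 0 \<le> Kk i" "\<And>i n. \<bar>m n i (2 * k)\<bar> \<le> Kk i / 2 ^ n"
    by metis
  define d where "d = real CARD('n) ^ k"
  define K where "K = 4 ^ k * (a * sum K2 UNIV + a ^ k * d * sum Kk UNIV)"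
  have d: "0 \<le> d" by (simp add: d_def)
  have pointwise: "(1 + a * (norm x)\<^sup>2) ^ k
      \<le> 1 + 4 ^ k * (a * (\<Sum>i\<in>UNIV. (x $ i) ^ 2) + a ^ k * d * (\<Sum>i\<in>UNIV. (x $ i) ^ (2 * k)))" for x :: "real ^ 'n"
  proof -
    have n2: "(norm x)\<^sup>2 = (\<Sum>i\<in>UNIV. (x $ i)\<^sup>2)"
      by (simp add: norm_vec_def L2_set_def sum_nonneg)
    have "(a * (norm x)\<^sup>2) ^ k \<le> a ^ k * (d * (\<Sum>i\<in>UNIV. ((x $ i)\<^sup>2) ^ k))"
      unfolding power_mult_distrib[of a] n2 d_def using a
      by (intro mult_left_mono sum_power_le) auto
    then have "a * (norm x)\<^sup>2 + (a * (norm x)\<^sup>2) ^ k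
      \<le> a * (\<Sum>i\<in>UNIV. (x $ i) ^ 2) + a ^ k * d * (\<Sum>i\<in>UNIV. (x $ i) ^ (2 * k))"
      by (simp add: n2 power_mult mult.assoc)
    then have "4 ^ k * (a * (norm x)\<^sup>2 + (a * (norm x)\<^sup>2) ^ k)
      \<le> 4 ^ k * (a * (\<Sum>i\<in>UNIV. (x $ i) ^ 2) + a ^ k * d * (\<Sum>i\<in>UNIV. (x $ i) ^ (2 * k)))"
      by (intro mult_left_mono) auto
    moreover have "(1 + a * (norm x)\<^sup>2) ^ k \<le> 1 + 4 ^ k * (a * (norm x)\<^sup>2 + (a * (norm x)\<^sup>2) ^ k)"
      using one_plus_power_le[of "a * (norm x)\<^sup>2" "k - 1"] a k by simp
    ultimately show ?thesis by linarith
  qed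
  have "(\<integral>\<^sup>+\<omega>. ennreal ((1 + a * (norm (L (1 / 2 ^ n) \<omega>))\<^sup>2) ^ k) \<partial>M) \<le> ennreal (1 + K / 2 ^ n)" for n
  proof -
    let ?X = "L (1 / 2 ^ n)"
    define f where "f \<omega> = 1 + 4 ^ k * (a * (\<Sum>i\<in>UNIV. (?X \<omega> $ i) ^ 2) + a ^ k * d * (\<Sum>i\<in>UNIV. (?X \<omega> $ i) ^ (2 * k)))" for \<omega>
    have int2: "integrable M (\<lambda>\<omega>. (?X \<omega> $ i) ^ 2)" and intk: "integrable M (\<lambda>\<omega>. (?X \<omega> $ i) ^ (2 * k))" for i
      using k by (intro integrable_levy_component[OF L int]; simp)+
    have S2: "(\<Sum>i\<in>UNIV. m n i 2) \<le> sum K2 UNIV / 2 ^ n"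
      unfolding sum_divide_distrib using K2(2) by (intro sum_mono) (meson abs_le_D1)
    have Sk: "(\<Sum>i\<in>UNIV. m n i (2 * k)) \<le> sum Kk UNIV / 2 ^ n"
      unfolding sum_divide_distrib using Kk(2) by (intro sum_mono) (meson abs_le_D1)
    have "(\<integral>\<^sup>+\<omega>. ennreal ((1 + a * (norm (?X \<omega>))\<^sup>2) ^ k) \<partial>M) \<le> (\<integral>\<^sup>+\<omega>. ennreal (f \<omega>) \<partial>M)"
      unfolding f_def by (intro nn_integral_mono ennreal_leI pointwise)
    also have "\<dots> = ennreal (expectation f)"
    proof (rule nn_integral_eq_integral)
      show "integrable M f"
        unfolding f_def by (intro Bochner_Integration.integrable_add integrable_mult_right
            Bochner_Integration.integrable_sum int2 intk integrable_const)
      show "AE \<omega> in M. 0 \<le> f \<omega>"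
        unfolding f_def power_mult using a d
        by (intro AE_I2 add_nonneg_nonneg mult_nonneg_nonneg sum_nonneg zero_le_power zero_le_power2) auto
    qed
    also have "expectation f = 1 + 4 ^ k * (a * (\<Sum>i\<in>UNIV. m n i 2) + a ^ k * d * (\<Sum>i\<in>UNIV. m n i (2 * k)))"
      unfolding f_def m_def using int2 intk by (simp add: Bochner_Integration.integral_sum prob_space)
    also have "ennreal \<dots> \<le> ennreal (1 + 4 ^ k * (a * (sum K2 UNIV / 2 ^ n) + a ^ k * d * (sum Kk UNIV / 2 ^ n)))"
      using a d S2 Sk by (intro ennreal_leI add_mono mult_left_mono mult_nonneg_nonneg) auto
    also have "1 + 4 ^ k * (a * (sum K2 UNIV / 2 ^ n) + a ^ k * d * (sum Kk UNIV / 2 ^ n)) = 1 + K / 2 ^ n"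
      by (simp add: K_def field_simps)
    finally show ?thesis .
  qed
  moreover have "0 \<le> K"
    unfolding K_def using a d K2(1) Kk(1)
    by (intro mult_nonneg_nonneg add_nonneg_nonneg sum_nonneg) auto
  ultimately show ?thesis by blast
qed

text \<open>The last increment is split off: everything before it is measurable at its starting
  time, so the expectation factorises, and stationarity replaces it by \<open>L h\<close>.\<close>

lemma nn_integral_prod_increments:
  fixes L :: "real \<Rightarrow> 'a \<Rightarrow> real ^ 'n" and \<phi> :: "real ^ 'n \<Rightarrow> ennreal"
  assumes L: "levy_process L" and g: "g \<in> borel_measurable (F 0)" and h: "0 \<le> h"
    and \<phi> [measurable]: "\<phi> \<in> borel_measurable borel"
  shows "(\<integral>\<^sup>+\<omega>. g \<omega> * (\<Prod>i<m. \<phi> (L (real (Suc i) * h) \<omega> - L (real i * h) \<omega>)) \<partial>M)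
    = (\<integral>\<^sup>+\<omega>. g \<omega> \<partial>M) * (\<integral>\<^sup>+\<omega>. \<phi> (L h \<omega>) \<partial>M) ^ m"
proof (induction m)
  case (Suc m)
  let ?s = "real m * h" and ?t = "real (Suc m) * h"
  let ?D = "\<lambda>\<omega>. L ?t \<omega> - L ?s \<omega>"
  define Z where "Z \<omega> = g \<omega> * (\<Prod>i<m. \<phi> (L (real (Suc i) * h) \<omega> - L (real i * h) \<omega>))" for \<omega>
  have st: "0 \<le> ?s" "?s \<le> ?t"
    using h by (auto simp: mult_right_mono)
  have [measurable]: "L ?s \<in> borel_measurable M" "L ?t \<in> borel_measurable M" "L h \<in> borel_measurable M"
    using st h by (auto intro!: measurable_F_M[OF levy_measurable[OF L]])
  have L_meas: "L (real i * h) \<in> borel_measurable (F ?s)" if "i \<le> m" for i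
    using that h by (intro measurable_F_mono[OF levy_measurable[OF L]] mult_right_mono) auto
  have "g \<in> borel_measurable (F ?s)"
    by (rule measurable_F_mono[OF g order_refl st(1)])
  then have Z: "Z \<in> borel_measurable (F ?s)"
    unfolding Z_def
    by (intro borel_measurable_times_ennreal borel_measurable_prod_ennreal measurable_compose[OF _ \<phi>]
        borel_measurable_diff L_meas) simp_all
  from indep_var_nn_integral_mult[OF indep_var_increment[OF L Z \<phi> st]]
  have "(\<integral>\<^sup>+\<omega>. Z \<omega> * \<phi> (?D \<omega>) \<partial>M) = (\<integral>\<^sup>+\<omega>. Z \<omega> \<partial>M) * (\<integral>\<^sup>+\<omega>. \<phi> (?D \<omega>) \<partial>M)"
    .
  also have "(\<integral>\<^sup>+\<omega>. \<phi> (?D \<omega>) \<partial>M) = (\<integral>\<^sup>+x. \<phi> x \<partial>distr M borel ?D)"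
    by (rule nn_integral_distr[symmetric]; measurable)
  also have "distr M borel ?D = distr M borel (L h)"
    using distr_increment[OF L st] by (simp add: algebra_simps)
  also have "(\<integral>\<^sup>+x. \<phi> x \<partial>distr M borel (L h)) = (\<integral>\<^sup>+\<omega>. \<phi> (L h \<omega>) \<partial>M)"
    by (rule nn_integral_distr; measurable)
  also have "(\<integral>\<^sup>+\<omega>. Z \<omega> \<partial>M) = (\<integral>\<^sup>+\<omega>. g \<omega> \<partial>M) * (\<integral>\<^sup>+\<omega>. \<phi> (L h \<omega>) \<partial>M) ^ m"
    unfolding Z_def by (rule Suc)
  finally show ?case
    by (simp add: Z_def mult_ac)
qed simp

text \<open>Fatou's lemma bounds the expected \<open>liminf\<close> of the discretised products by
  \<open>E g\<close> times \<open>lim (1 + K / 2 ^ n) ^ (N 2 ^ n) = exp (K N)\<close>.\<close>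

lemma nn_integral_liminf_products:
  fixes L :: "real \<Rightarrow> 'a \<Rightarrow> real ^ 'n" and N :: nat
  assumes L: "levy_process L" and int: "integrable M (\<lambda>\<omega>. norm (L 1 \<omega>) ^ (2 * k))"
    and k: "1 \<le> k" and a: "0 \<le> a"
    and g: "g \<in> borel_measurable (F 0)" "\<And>\<omega>. 0 \<le> g \<omega>" and g_int: "integrable M g"
  defines "G \<equiv> \<lambda>\<omega>. liminf (\<lambda>n. ennreal (g \<omega> *
      (\<Prod>i<N * 2 ^ n. 1 + a * (norm (L (real (Suc i) / 2 ^ n) \<omega> - L (real i / 2 ^ n) \<omega>))\<^sup>2) ^ k))"
  shows "G \<in> borel_measurable M" "(\<integral>\<^sup>+\<omega>. G \<omega> \<partial>M) < \<infinity>"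
proof -
  define \<phi> where "\<phi> x = ennreal ((1 + a * (norm x)\<^sup>2) ^ k)" for x :: "real ^ 'n"
  have \<phi> [measurable]: "\<phi> \<in> borel_measurable borel" unfolding \<phi>_def by measurable
  have [measurable]: "g \<in> borel_measurable M" by (rule measurable_F_M[OF g(1)]) simp
  have [measurable]: "L (real i / 2 ^ n) \<in> borel_measurable M" for i n
    by (intro measurable_F_M[OF levy_measurable[OF L]]) auto
  let ?p = "\<lambda>n \<omega>. ennreal (g \<omega> *
      (\<Prod>i<N * 2 ^ n. 1 + a * (norm (L (real (Suc i) / 2 ^ n) \<omega> - L (real i / 2 ^ n) \<omega>))\<^sup>2) ^ k)"
  have p_meas [measurable]: "?p n \<in> borel_measurable M" for n
    by measurable
  show "G \<in> borel_measurable M"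
    unfolding G_def by measurable
  obtain K where K: "0 \<le> K" "\<And>n. (\<integral>\<^sup>+\<omega>. \<phi> (L (1 / 2 ^ n) \<omega>) \<partial>M) \<le> ennreal (1 + K / 2 ^ n)"
    using levy_dyadic_factor[OF L int k a] unfolding \<phi>_def by blast
  have bound: "(\<integral>\<^sup>+\<omega>. ?p n \<omega> \<partial>M) \<le> (\<integral>\<^sup>+\<omega>. ennreal (g \<omega>) \<partial>M) * ennreal (exp (K * real N))" for n
  proof -
    have "?p n \<omega> = ennreal (g \<omega>) * (\<Prod>i<N * 2 ^ n. \<phi> (L (real (Suc i) * (1 / 2 ^ n)) \<omega> - L (real i * (1 / 2 ^ n)) \<omega>))" for \<omega>
      using a g(2)[of \<omega>] by (simp add: \<phi>_def ennreal_mult prod_ennreal prod_power_distrib add_nonneg_nonneg prod_nonneg)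
    then have "(\<integral>\<^sup>+\<omega>. ?p n \<omega> \<partial>M) = (\<integral>\<^sup>+\<omega>. ennreal (g \<omega>) \<partial>M) * (\<integral>\<^sup>+\<omega>. \<phi> (L (1 / 2 ^ n) \<omega>) \<partial>M) ^ (N * 2 ^ n)"
      using nn_integral_prod_increments[OF L _ _ \<phi>, of "\<lambda>\<omega>. ennreal (g \<omega>)" "1 / 2 ^ n" "N * 2 ^ n"] g(1)
      by (simp add: measurable_compose[OF _ measurable_ennreal])
    also have "\<dots> \<le> (\<integral>\<^sup>+\<omega>. ennreal (g \<omega>) \<partial>M) * ennreal (1 + K / 2 ^ n) ^ (N * 2 ^ n)"
      by (intro mult_left_mono power_mono K(2)) auto
    also have "ennreal (1 + K / 2 ^ n) ^ (N * 2 ^ n) = ennreal ((1 + K / 2 ^ n) ^ (N * 2 ^ n))"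
      using K(1) by (intro ennreal_power add_nonneg_nonneg) auto
    also have "\<dots> \<le> ennreal (exp (K * real N))"
    proof (rule ennreal_leI)
      \<comment> \<open>Bounding each factor by an exponential removes the dependence on
        \<open>n\<close>.\<close>
      have "(1 + K / 2 ^ n) ^ (N * 2 ^ n) \<le> exp (K / 2 ^ n) ^ (N * 2 ^ n)"
        using K(1) by (intro power_mono exp_ge_add_one_self) (auto intro!: add_nonneg_nonneg)
      also have "\<dots> = exp (K * real N)"
        by (simp add: exp_of_nat_mult[symmetric])
      finally show "(1 + K / 2 ^ n) ^ (N * 2 ^ n) \<le> exp (K * real N)" .
    qed
    finally show ?thesis by (simp add: mult_left_mono)
  qed
  have "(\<integral>\<^sup>+\<omega>. G \<omega> \<partial>M) \<le> liminf (\<lambda>n. \<integral>\<^sup>+\<omega>. ?p n \<omega> \<partial>M)"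
    unfolding G_def by (rule nn_integral_liminf) measurable
  also have "\<dots> \<le> (\<integral>\<^sup>+\<omega>. ennreal (g \<omega>) \<partial>M) * ennreal (exp (K * real N))"
    by (rule order_trans[OF Liminf_mono[OF always_eventually[OF allI[OF bound]]]]) (simp add: Liminf_const)
  also have "\<dots> < \<infinity>"
    using g_int g(2) by (auto simp: integrable_iff_bounded ennreal_mult_less_top)
  finally show "(\<integral>\<^sup>+\<omega>. G \<omega> \<partial>M) < \<infinity>" .
qed

end

section \<open>Equivalence of norms\<close>

text \<open>Nonnegativity is not an axiom of \<open>is_norm\<close>; it follows from subadditivity
  applied to \<open>x\<close> and its negative.\<close>

lemma is_norm_nonneg:
  assumes "is_norm N"
  shows "0 \<le> N x"
proof -
  have "N (x + (- 1) *\<^sub>R x) \<le> N x + N ((- 1) *\<^sub>R x)"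
    using assms unfolding is_norm_def by blast
  moreover have "N ((- 1) *\<^sub>R x) = \<bar>- 1\<bar> * N x" "N 0 = 0"
    using assms unfolding is_norm_def by blast+
  ultimately show ?thesis by simp
qed

lemma is_norm_le_norm:
  fixes N :: "'v :: euclidean_space \<Rightarrow> real"
  assumes N: "is_norm N"
  obtains c where "c > 0" "\<And>x. N x \<le> c * norm x"
proof
  \<comment> \<open>The added 1 only secures strict positivity of the constant.\<close>
  let ?c = "(\<Sum>b\<in>Basis. N b) + 1"
  have sum_le: "N (sum f S) \<le> (\<Sum>b\<in>S. N (f b))" if "finite S" for f :: "'v \<Rightarrow> 'v" and S
    using that
  proof (induction S)
    case empty
    have "N 0 = 0" using N unfolding is_norm_def by blast
    then show ?case by simp
  next
    case (insert x S)
    have "N (f x + sum f S) \<le> N (f x) + N (sum f S)"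
      using N unfolding is_norm_def by blast
    then show ?case using insert by simp
  qed
  show "?c > 0"
    using is_norm_nonneg[OF N] by (intro add_nonneg_pos sum_nonneg) auto
  show "N x \<le> ?c * norm x" for x
  proof -
    have "N x = N (\<Sum>b\<in>Basis. (x \<bullet> b) *\<^sub>R b)"
      by (simp add: euclidean_representation)
    also have "\<dots> \<le> (\<Sum>b\<in>Basis. N ((x \<bullet> b) *\<^sub>R b))"
      by (rule sum_le) simp
    also have "\<dots> = (\<Sum>b\<in>Basis. \<bar>x \<bullet> b\<bar> * N b)"
      using N by (simp add: is_norm_def)
    also have "\<dots> \<le> (\<Sum>b\<in>Basis. norm x * N b)"
      using is_norm_nonneg[OF N] by (intro sum_mono mult_right_mono Basis_le_norm) auto
    also have "\<dots> = norm x * sum N Basis"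
      by (rule sum_distrib_left[symmetric])
    also have "\<dots> \<le> ?c * norm x"
      by (simp add: algebra_simps)
    finally show ?thesis .
  qed
qed

lemma continuous_on_is_norm:
  fixes N :: "'v :: euclidean_space \<Rightarrow> real"
  assumes N: "is_norm N"
  shows "continuous_on S N"
proof -
  obtain c where c: "c > 0" "\<And>x. N x \<le> c * norm x"
    using is_norm_le_norm[OF N] by blast
  have diff: "N x - N y \<le> c * norm (x - y)" for x y
  proof -
    have "N ((x - y) + y) \<le> N (x - y) + N y"
      using N unfolding is_norm_def by blast
    then show ?thesis using c(2)[of "x - y"] by simp
  qed
  have "c-lipschitz_on S N"
  proof (rule lipschitz_onI)
    show "dist (N x) (N y) \<le> c * dist x y" for x y
      using diff[of x y] diff[of y x] by (simp add: dist_real_def dist_norm norm_minus_commute abs_le_iff)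
  qed (use c in simp)
  then show ?thesis by (rule lipschitz_on_continuous_on)
qed

text \<open>\<open>N\<close> attains a minimum on the compact Euclidean unit sphere, which is
  therefore positive; its reciprocal is the constant.\<close>

lemma norm_le_is_norm:
  fixes N :: "'v :: euclidean_space \<Rightarrow> real"
  assumes N: "is_norm N"
  obtains c where "c > 0" "\<And>x. norm x \<le> c * N x"
proof -
  have "\<exists>w\<in>sphere 0 1. \<forall>v\<in>sphere 0 1. N w \<le> N v"
    by (intro continuous_attains_inf compact_sphere continuous_on_is_norm[OF N]) simp
  then obtain w where w: "norm w = 1" "\<And>v. norm v = 1 \<Longrightarrow> N w \<le> N v"
    by auto
  have "N w \<noteq> 0"
    using N w(1) unfolding is_norm_def by (metis norm_zero zero_neq_one)
  then have pos: "0 < N w" using is_norm_nonneg[OF N, of w] by simp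
  show ?thesis
  proof (rule that[of "1 / N w"])
    show "norm x \<le> 1 / N w * N x" for x
    proof (cases "x = 0")
      case False
      have "N w \<le> N ((1 / norm x) *\<^sub>R x)"
        using False by (intro w(2)) simp
      also have "\<dots> = \<bar>1 / norm x\<bar> * N x"
        using N unfolding is_norm_def by blast
      finally show ?thesis using False pos by (simp add: field_simps)
    qed (use is_norm_nonneg[OF N] pos in simp)
  qed (use pos in simp)
qed

lemma integrable_norm_power_if_is_norm:
  fixes N :: "'v :: euclidean_space \<Rightarrow> real"
  assumes N: "is_norm N" and int: "integrable M (\<lambda>\<omega>. N (X \<omega>) ^ p)"
    and X: "X \<in> borel_measurable M"
  shows "integrable M (\<lambda>\<omega>. norm (X \<omega>) ^ p)"
proof -
  obtain c where c: "c > 0" "\<And>x. norm x \<le> c * N x"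
    using norm_le_is_norm[OF N] by blast
  show ?thesis
  proof (rule Bochner_Integration.integrable_bound)
    show "integrable M (\<lambda>\<omega>. c ^ p * N (X \<omega>) ^ p)"
      using int by simp
    show "(\<lambda>\<omega>. norm (X \<omega>) ^ p) \<in> borel_measurable M"
      using X by measurable
    have "norm x ^ p \<le> c ^ p * N x ^ p" for x
      unfolding power_mult_distrib[symmetric] by (intro power_mono c) simp
    then show "AE \<omega> in M. norm (norm (X \<omega>) ^ p) \<le> norm (c ^ p * N (X \<omega>) ^ p)"
      using c(1) is_norm_nonneg[OF N] by (simp add: abs_mult)
  qed
qed

section \<open>Moments of the volatility process\<close>

context usual_filtered_prob_space
begin

text \<open>One integrable majorant for all times up to \<open>N\<close> yields the finite moments
  and a bound uniform in \<open>t\<close> simultaneously.\<close>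

lemma mucogarch_dominated:
  fixes L :: "real \<Rightarrow> 'a \<Rightarrow> real ^ 'n" and A B C :: "real ^ 'n ^ 'n" and N :: nat
  assumes L: "levy_process L" and int: "integrable M (\<lambda>\<omega>. norm (L 1 \<omega>) ^ (2 * k))"
    and k: "1 \<le> k" and C: "pos_def C" and Y: "mucogarch_volatility A B C L Y"
    and Y0: "integrable M (\<lambda>\<omega>. norm (Y 0 \<omega>) ^ k)"
  shows "\<exists>H. integrable M H \<and> (AE \<omega> in M. \<forall>t\<in>{0..real N}. norm (Y t \<omega>) ^ k \<le> H \<omega>)"
proof -
  obtain a where a: "0 < a" and path:
    "\<And>Y l N Q t. mucogarch_path A B C l Y \<Longrightarrow>
       (\<And>S. finite S \<Longrightarrow> S \<subseteq> {0<..N} \<Longrightarrow> (\<Prod>s\<in>S. 1 + a * (norm (jump l s))\<^sup>2) \<le> Q) \<Longrightarrow>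
       0 \<le> t \<Longrightarrow> t \<le> N \<Longrightarrow> norm (Y t) \<le> (norm (Y 0) + norm C + 1) * exp (a * N) * Q"
    using mucogarch_pathwise_bound[OF C, of A B] by metis
  \<comment> \<open>The time-0 factor of the pathwise bound, to the power \<open>k\<close>. It is
    \<open>F 0\<close>-measurable, so it factors out of the expectation, and only the
    \<open>k\<close>-th moment of \<open>Y 0\<close> is needed.\<close>
  define g where "g \<omega> = (norm (Y 0 \<omega>) + norm C + 1) ^ k" for \<omega>
  have Y0_meas: "Y 0 \<in> borel_measurable (F 0)"
    using Y by (simp add: mucogarch_volatility_def adapted_def)
  then have g_meas: "g \<in> borel_measurable (F 0)"
    unfolding g_def by measurable
  have Y0_meas' [measurable]: "Y 0 \<in> borel_measurable M"
    by (rule measurable_F_M[OF Y0_meas]) simp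
  have g_ge_1: "1 \<le> g \<omega>" for \<omega>
    unfolding g_def by (intro one_le_power) simp
  have g_int: "integrable M g"
  proof (rule Bochner_Integration.integrable_bound)
    show "integrable M (\<lambda>\<omega>. 2 ^ k * (norm (Y 0 \<omega>) ^ k + (norm C + 1) ^ k))"
      using Y0 by auto
    show "g \<in> borel_measurable M" unfolding g_def by measurable
    show "AE \<omega> in M. norm (g \<omega>) \<le> norm (2 ^ k * (norm (Y 0 \<omega>) ^ k + (norm C + 1) ^ k))"
    proof (rule AE_I2)
      fix \<omega>
      have "0 \<le> g \<omega>" using g_ge_1[of \<omega>] by simp
      moreover have "g \<omega> \<le> 2 ^ k * (norm (Y 0 \<omega>) ^ k + (norm C + 1) ^ k)"
        using power_add_le_two_power[of "norm (Y 0 \<omega>)" "norm C + 1" k] by (simp add: g_def add.assoc)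
      ultimately show "norm (g \<omega>) \<le> norm (2 ^ k * (norm (Y 0 \<omega>) ^ k + (norm C + 1) ^ k))"
        unfolding real_norm_def by linarith
    qed
  qed
  \<comment> \<open>A measurable majorant of \<open>g\<close> times the \<open>k\<close>-th power of
    every finite jump product; a supremum over uncountably many finite sets is not evidently
    measurable.\<close>
  define G where "G \<omega> = liminf (\<lambda>n. ennreal (g \<omega> *
      (\<Prod>i<N * 2 ^ n. 1 + a * (norm (L (real (Suc i) / 2 ^ n) \<omega> - L (real i / 2 ^ n) \<omega>))\<^sup>2) ^ k))" for \<omega>
  have G: "G \<in> borel_measurable M" "(\<integral>\<^sup>+\<omega>. G \<omega> \<partial>M) < \<infinity>"
    using nn_integral_liminf_products[OF L int k less_imp_le[OF a] g_meas _ g_int, of N]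
      order_trans[OF zero_le_one g_ge_1] unfolding G_def by auto
  \<comment> \<open>\<open>enn2real\<close> sends infinity to 0, which concerns only a null set
    because \<open>G\<close> is almost surely finite.\<close>
  define H where "H \<omega> = exp (a * real N) ^ k * enn2real (G \<omega>)" for \<omega>
  have "integrable M (\<lambda>\<omega>. enn2real (G \<omega>))"
  proof (rule integrableI_bounded)
    show "(\<lambda>\<omega>. enn2real (G \<omega>)) \<in> borel_measurable M"
      using G(1) by measurable
    have "(\<integral>\<^sup>+\<omega>. ennreal (norm (enn2real (G \<omega>))) \<partial>M) \<le> (\<integral>\<^sup>+\<omega>. G \<omega> \<partial>M)"
      by (intro nn_integral_mono) (simp add: ennreal_enn2real_if)
    then show "(\<integral>\<^sup>+\<omega>. ennreal (norm (enn2real (G \<omega>))) \<partial>M) < \<infinity>"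
      using G(2) by (rule le_less_trans)
  qed
  then have "integrable M H" unfolding H_def by simp
  moreover have "AE \<omega> in M. \<forall>t\<in>{0..real N}. norm (Y t \<omega>) ^ k \<le> H \<omega>"
  proof -
    have "AE \<omega> in M. G \<omega> \<noteq> \<infinity>"
      using G by (intro nn_integral_PInf_AE) auto
    moreover have "AE \<omega> in M. cadlag (\<lambda>t. L t \<omega>)"
      using L by (simp add: levy_process_def)
    moreover have "AE \<omega> in M. mucogarch_path A B C (\<lambda>t. L t \<omega>) (\<lambda>t. Y t \<omega>)"
      using Y unfolding mucogarch_volatility_def mucogarch_path_def Let_def by (auto simp: AE_conj_iff)
    ultimately show ?thesis
    proof eventually_elim
      case (elim \<omega>)
      define r where "r = enn2real (G \<omega>)"
      have Gr: "G \<omega> = ennreal r" using elim(1) by (simp add: r_def ennreal_enn2real_if)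
      have g0: "0 < g \<omega>" using g_ge_1[of \<omega>] by simp
      have r0: "0 \<le> r" by (simp add: r_def)
      \<comment> \<open>Chosen so that \<open>g \<omega> * Q ^ k = r\<close>: the
        \<open>k\<close>-th power of the pathwise bound then reduces to
        \<open>H \<omega>\<close>.\<close>
      define Q where "Q = root k (r / g \<omega>)"
      have Qk: "Q ^ k = r / g \<omega>" using k r0 g0 by (simp add: Q_def)
      have prod_Q: "(\<Prod>s\<in>S. 1 + a * (norm (jump (\<lambda>t. L t \<omega>) s))\<^sup>2) \<le> Q" if S: "finite S" "S \<subseteq> {0<..real N}" for S
      proof -
        let ?p = "\<Prod>s\<in>S. 1 + a * (norm (jump (\<lambda>t. L t \<omega>) s))\<^sup>2"
        have p0: "0 \<le> ?p" using a by (intro prod_nonneg) (simp add: add_nonneg_nonneg)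
        have "ennreal (g \<omega> * ?p ^ k) \<le> G \<omega>"
          unfolding G_def by (rule jump_product_le_liminf[OF elim(2) S]) (use a g0 in auto)
        then have "g \<omega> * ?p ^ k \<le> r"
          unfolding Gr using r0 by (simp add: ennreal_le_iff)
        then have "?p ^ k \<le> r / g \<omega>"
          using g0 by (simp add: field_simps)
        then have "root k (?p ^ k) \<le> Q"
          using k unfolding Q_def by (intro real_root_le_mono) auto
        then show ?thesis using k p0 by (simp add: real_root_power_cancel)
      qed
      show ?case
      proof
        fix t assume t: "t \<in> {0..real N}"
        have "norm (Y t \<omega>) \<le> (norm (Y 0 \<omega>) + norm C + 1) * exp (a * real N) * Q"
          using t by (intro path[OF elim(3)] prod_Q) auto
        then have "norm (Y t \<omega>) ^ k \<le> ((norm (Y 0 \<omega>) + norm C + 1) * exp (a * real N) * Q) ^ k"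
          by (intro power_mono) auto
        also have "\<dots> = g \<omega> * exp (a * real N) ^ k * (r / g \<omega>)"
          by (simp add: power_mult_distrib Qk g_def)
        also have "\<dots> = H \<omega>"
          using g0 by (simp add: H_def r_def)
        finally show "norm (Y t \<omega>) ^ k \<le> H \<omega>" .
      qed
    qed
  qed
  ultimately show ?thesis by blast
qed

end

theorem proposition4p3:
  fixes M :: "'a measure" and F :: "real \<Rightarrow> 'a measure"
    and L :: "real \<Rightarrow> 'a \<Rightarrow> real ^ 'd"
    and Y :: "real \<Rightarrow> 'a \<Rightarrow> real ^ 'd ^ 'd"
    and A B C :: "real ^ 'd ^ 'd"
    and vnorm :: "real ^ 'd \<Rightarrow> real" and mnorm :: "real ^ 'd ^ 'd \<Rightarrow> real"
    and k :: nat
  assumes "usual_filtered_prob_space M F"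
    and "is_norm vnorm" and "is_norm mnorm"
    and "usual_filtered_prob_space.levy_process M F L"
    and "pos_def C"
    and "usual_filtered_prob_space.mucogarch_volatility M F A B C L Y"
    and "k \<ge> 1"
    and "integrable M (\<lambda>\<omega>. mnorm (Y 0 \<omega>) ^ k)"
    and "diagonalizable_over_complex B"
    and "integrable M (\<lambda>\<omega>. vnorm (L 1 \<omega>) ^ (2 * k))"
  shows "(\<forall>t\<ge>0. integrable M (\<lambda>\<omega>. mnorm (Y t \<omega>) ^ k)) \<and>
         locally_bounded_on {0..} (\<lambda>t. prob_space.expectation M (\<lambda>\<omega>. mnorm (Y t \<omega>) ^ k))"
proof -
  interpret usual_filtered_prob_space M F by fact
  note L = assms(4) and Y = assms(6)
  have Y_meas: "Y t \<in> borel_measurable M" if "0 \<le> t" for t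
    using Y that by (intro measurable_F_M[of "Y t" t]) (auto simp: mucogarch_volatility_def adapted_def)
  have intL: "integrable M (\<lambda>\<omega>. norm (L 1 \<omega>) ^ (2 * k))"
    by (rule integrable_norm_power_if_is_norm[OF assms(2,10)])
      (rule measurable_F_M[OF levy_measurable[OF L]], simp_all)
  have intY0: "integrable M (\<lambda>\<omega>. norm (Y 0 \<omega>) ^ k)"
    by (rule integrable_norm_power_if_is_norm[OF assms(3,8) Y_meas]) simp
  obtain c where c: "c > 0" "\<And>x. mnorm x \<le> c * norm x"
    using is_norm_le_norm[OF assms(3)] by blast
  note mnorm_nonneg = is_norm_nonneg[OF assms(3)]
  have bound: "\<exists>K. \<forall>t\<in>{0..real N}. integrable M (\<lambda>\<omega>. mnorm (Y t \<omega>) ^ k) \<and>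
      \<bar>expectation (\<lambda>\<omega>. mnorm (Y t \<omega>) ^ k)\<bar> \<le> K" for N :: nat
  proof -
    obtain H where H: "integrable M H" "AE \<omega> in M. \<forall>t\<in>{0..real N}. norm (Y t \<omega>) ^ k \<le> H \<omega>"
      using mucogarch_dominated[OF L intL assms(7,5) Y intY0] by blast
    have intH: "integrable M (\<lambda>\<omega>. c ^ k * H \<omega>)" using H(1) by simp
    have "integrable M (\<lambda>\<omega>. mnorm (Y t \<omega>) ^ k) \<and>
      \<bar>expectation (\<lambda>\<omega>. mnorm (Y t \<omega>) ^ k)\<bar> \<le> expectation (\<lambda>\<omega>. c ^ k * H \<omega>)" if t: "t \<in> {0..real N}" for t
    proof -
      have le: "AE \<omega> in M. mnorm (Y t \<omega>) ^ k \<le> c ^ k * H \<omega>"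
        using H(2)
      proof eventually_elim
        case (elim \<omega>)
        have "mnorm (Y t \<omega>) ^ k \<le> (c * norm (Y t \<omega>)) ^ k"
          by (intro power_mono c mnorm_nonneg)
        also have "\<dots> \<le> c ^ k * H \<omega>"
          unfolding power_mult_distrib using elim t c(1) by (intro mult_left_mono) auto
        finally show ?case .
      qed
      have int: "integrable M (\<lambda>\<omega>. mnorm (Y t \<omega>) ^ k)"
      proof (rule Bochner_Integration.integrable_bound[OF intH])
        have "mnorm \<in> borel_measurable borel"
          by (intro borel_measurable_continuous_onI continuous_on_is_norm assms(3))
        then have "(\<lambda>\<omega>. mnorm (Y t \<omega>)) \<in> borel_measurable M"
          using Y_meas[of t] t by (auto intro: measurable_compose)
        then show "(\<lambda>\<omega>. mnorm (Y t \<omega>) ^ k) \<in> borel_measurable M"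
          by measurable
        show "AE \<omega> in M. norm (mnorm (Y t \<omega>) ^ k) \<le> norm (c ^ k * H \<omega>)"
          using le by eventually_elim (use mnorm_nonneg in \<open>simp add: abs_of_nonneg\<close>)
      qed
      have "0 \<le> expectation (\<lambda>\<omega>. mnorm (Y t \<omega>) ^ k)"
        using mnorm_nonneg by (intro Bochner_Integration.integral_nonneg) auto
      moreover have "expectation (\<lambda>\<omega>. mnorm (Y t \<omega>) ^ k) \<le> expectation (\<lambda>\<omega>. c ^ k * H \<omega>)"
        by (rule integral_mono_AE[OF int intH le])
      ultimately show ?thesis using int by simp
    qed
    then show ?thesis by blast
  qed
  have "integrable M (\<lambda>\<omega>. mnorm (Y t \<omega>) ^ k)" if "0 \<le> t" for t
  proof -
    obtain N where "t \<le> real N" using real_arch_simple by blast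
    then show ?thesis using bound[of N] that by auto
  qed
  moreover have "locally_bounded_on {0..} (\<lambda>t. expectation (\<lambda>\<omega>. mnorm (Y t \<omega>) ^ k))"
    unfolding locally_bounded_on_def
  proof
    fix t :: real assume "t \<in> {0..}"
    \<comment> \<open>The extra 1 makes \<open>{0..real N}\<close> contain a whole neighbourhood of
      \<open>t\<close> in the time axis.\<close>
    obtain N where N: "t + 1 \<le> real N" using real_arch_simple by blast
    obtain K where K: "\<And>s. s \<in> {0..real N} \<Longrightarrow> \<bar>expectation (\<lambda>\<omega>. mnorm (Y s \<omega>) ^ k)\<bar> \<le> K"
      using bound[of N] by blast
    have "bounded ((\<lambda>t. expectation (\<lambda>\<omega>. mnorm (Y t \<omega>) ^ k)) ` ({..<t + 1} \<inter> {0..}))"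
      unfolding bounded_iff using N by (intro exI[of _ K]) (auto intro!: K)
    then show "\<exists>U. open U \<and> t \<in> U \<and> bounded ((\<lambda>t. expectation (\<lambda>\<omega>. mnorm (Y t \<omega>) ^ k)) ` (U \<inter> {0..}))"
      by (intro exI[of _ "{..<t + 1}"]) auto
  qed
  ultimately show ?thesis by blast
qed

end
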